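(* Let $X$ and $Y$ be compact Hausdorff spaces, let $M$ be a self-conjugate subspace of $C(X)$, and let $S\subseteq M$ be a function space on $X$. Let $\{T_n\}_{n\in\mathbb N}$ be a sequence of positive linear maps $T_n:M\to C(Y)$, and let $T_\infty:M\to C(Y)$ be an isometry (not assumed linear) of $M$ onto a subspace $T_\infty(M)$ of $C(Y)$. Let $N:=\mathrm{Span}\bigcup_{1\le n\le\infty}T_n(M)\subseteq C(Y)$. Assume that $T_nf(y)\to T_\infty f(y)$ for every $y\in Y$ and every $f\in S$, that $Ch(N)\subseteq Ch(T_\infty(S))$, and that the set $\{T_n1:n\in\mathbb N\}$ is bounded in $C(Y)$. Then $T_nf(y)\to T_\infty f(y)$ for every $y\in Y$ and every $f\in M$.
   Context: For a compact Hausdorff space $Z$, $C(Z)$ denotes the space of continuous scalar-valued functions on $Z$ (the scalars being either all real or all complex), with the supremum norm $\|\cdot\|$. A subspace $M\subseteq C(X)$ is self-conjugate if $\bar f\in M$ whenever $f\in M$. A function space on $X$ is a linear subspace of $C(X)$ containing the constant function $1$ and separating the points of $X$. A linear map $T:M\to C(Y)$ is positive if $Tf\ge 0$ whenever $f\ge 0$. An isometry means $\|T_\infty f-T_\infty g\|=\|f-g\|$ for all $f,g\in M$. For a linear subspace $A\subseteq C(Z)$, its Choquet boundary $Ch(A)$ is the set of points $z\in Z$ such that the evaluation functional $\delta_z:A\to$ scalars, $g\mapsto g(z)$, is an extreme point of the closed unit ball of the dual space of $(A,\|\cdot\|)$. *)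

theory Defs
  imports "HOL-Analysis.Analysis" "HOL-Library.Complex_Order"
begin

text \<open>Scalars 'k are either real or complex (the order on complex is the one of
HOL-Library.Complex_Order: 0 \<le> z iff z is real and nonnegative).
A compact Hausdorff space is a type of class t2_space whose UNIV is compact.\<close>

definition CC :: "('z::topological_space \<Rightarrow> 'k::real_normed_field) set" where
  "CC = {f. continuous_on UNIV f}"

definition supn :: "('z \<Rightarrow> 'k::real_normed_field) \<Rightarrow> real" where
  "supn f = (SUP z. norm (f z))"

definition lin_subspace :: "('z \<Rightarrow> 'k::real_normed_field) set \<Rightarrow> bool" where
  "lin_subspace A \<longleftrightarrow> (\<lambda>_. 0) \<in> A \<and>
     (\<forall>f\<in>A. \<forall>g\<in>A. (\<lambda>z. f z + g z) \<in> A) \<and>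
     (\<forall>a. \<forall>f\<in>A. (\<lambda>z. a * f z) \<in> A)"

definition kspan :: "('z \<Rightarrow> 'k::real_normed_field) set \<Rightarrow> ('z \<Rightarrow> 'k) set" where
  "kspan B = \<Inter>{A. lin_subspace A \<and> B \<subseteq> A}"

definition self_conjugate :: "('k \<Rightarrow> 'k) \<Rightarrow> ('z \<Rightarrow> 'k::real_normed_field) set \<Rightarrow> bool" where
  "self_conjugate cj M \<longleftrightarrow> (\<forall>f\<in>M. (\<lambda>z. cj (f z)) \<in> M)"

definition function_space :: "('z::topological_space \<Rightarrow> 'k::real_normed_field) set \<Rightarrow> bool" where
  "function_space S \<longleftrightarrow> lin_subspace S \<and> S \<subseteq> CC \<and> (\<lambda>_. 1) \<in> S \<and>
     (\<forall>x y. x \<noteq> y \<longrightarrow> (\<exists>f\<in>S. f x \<noteq> f y))"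

definition linear_on :: "('a \<Rightarrow> 'k) set \<Rightarrow> (('a \<Rightarrow> 'k) \<Rightarrow> ('b \<Rightarrow> 'k::real_normed_field)) \<Rightarrow> bool" where
  "linear_on M T \<longleftrightarrow> (\<forall>f\<in>M. \<forall>g\<in>M. \<forall>a b.
       T (\<lambda>x. a * f x + b * g x) = (\<lambda>y. a * T f y + b * T g y))"

definition positive_on :: "('a \<Rightarrow> 'k) set \<Rightarrow> (('a \<Rightarrow> 'k) \<Rightarrow> ('b \<Rightarrow> 'k::{real_normed_field,ord})) \<Rightarrow> bool" where
  "positive_on M T \<longleftrightarrow> (\<forall>f\<in>M. (\<forall>x. 0 \<le> f x) \<longrightarrow> (\<forall>y. 0 \<le> T f y))"

definition isometry_on :: "('a \<Rightarrow> 'k) set \<Rightarrow> (('a \<Rightarrow> 'k) \<Rightarrow> ('b \<Rightarrow> 'k::real_normed_field)) \<Rightarrow> bool" where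
  "isometry_on M T \<longleftrightarrow> (\<forall>f\<in>M. \<forall>g\<in>M.
       supn (\<lambda>y. T f y - T g y) = supn (\<lambda>x. f x - g x))"

definition dual_ball :: "('z \<Rightarrow> 'k::real_normed_field) set \<Rightarrow> (('z \<Rightarrow> 'k) \<Rightarrow> 'k) set" where
  "dual_ball A = {\<phi>. (\<forall>f\<in>A. \<forall>g\<in>A. \<forall>a b. \<phi> (\<lambda>z. a * f z + b * g z) = a * \<phi> f + b * \<phi> g) \<and>
                      (\<forall>f\<in>A. norm (\<phi> f) \<le> supn f)}"

text \<open>Extreme points of the dual ball (functionals are identified when they agree on A).\<close>
definition dual_extreme :: "('z \<Rightarrow> 'k::real_normed_field) set \<Rightarrow> (('z \<Rightarrow> 'k) \<Rightarrow> 'k) \<Rightarrow> bool" where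
  "dual_extreme A \<psi> \<longleftrightarrow> \<psi> \<in> dual_ball A \<and>
     (\<forall>\<phi>1\<in>dual_ball A. \<forall>\<phi>2\<in>dual_ball A. \<forall>t::real. 0 < t \<and> t < 1 \<and>
        (\<forall>f\<in>A. \<psi> f = of_real t * \<phi>1 f + of_real (1 - t) * \<phi>2 f)
        \<longrightarrow> (\<forall>f\<in>A. \<phi>1 f = \<phi>2 f))"

text \<open>Choquet boundary of (the linear span of) A.  For a linear subspace A, kspan A = A.\<close>
definition choquet :: "('z \<Rightarrow> 'k::real_normed_field) set \<Rightarrow> 'z set" where
  "choquet A = {z. dual_extreme (kspan A) (\<lambda>g. g z)}"

end

theory Submission
  imports Defs "HOL-Library.Function_Algebras"
begin

text \<open>Let \<open>N\<close> be the span of the ranges. Every function in the uniform closure of \<open>N\<close> attains its norm on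
  \<open>Ch(N)\<close>, so Simons' inequality (in the spirit of Rainwater's theorem) reduces pointwise convergence of
  the bounded sequence \<open>T n f - Tinf f\<close> on \<open>Y\<close> to convergence at each \<open>y \<in> Ch(N)\<close>. For such \<open>y\<close> the
  functional \<open>s \<mapsto> Tinf s y\<close> is an extreme point of the dual ball of \<open>S\<close>, hence evaluation at a point \<open>x\<close>,
  and by the Hahn-Banach theorem every real continuous \<open>u\<close> on \<open>X\<close> is dominated by some \<open>Re s\<close> with
  \<open>s \<in> S\<close> and \<open>Re (s x)\<close> arbitrarily close to \<open>u x\<close>. Positivity squeezes \<open>T n f y\<close> to \<open>f x\<close>, and the
  same domination together with the isometry property gives \<open>Tinf f y = f x\<close>. Scalars are treated
  uniformly by passing to the real functions \<open>(y, c) \<mapsto> Re (c g(y))\<close> with \<open>|c| = 1\<close>.\<close>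

section \<open>Extreme linear minorants of sublinear functionals\<close>

text \<open>Linear minorants of the supremum on C(W) play the part of probability measures on W, and
  certain sublinear functionals that of faces of the set of minorants. Extreme points then come from
  Zorn's lemma without a topology on the dual, and a measure being carried by a closed set is
  expressed through vanishing variances. The infinite convex combinations in Simons' argument leave
  N, which is why the uniform closure appears; extreme points for the closure are still extreme for
  N. An extreme functional of the dual ball of S could be an evaluation times a scalar of modulus
  one. Here \<open>Tinf 1 y\<close> is a limit of nonnegative reals, and extremality makes it 1,
  which rules such a factor out. \<open>Tinf\<close> is not assumed linear. On S it is linear as a
  pointwise limit of linear maps; off S its value at a boundary point is determined by distances to
  elements of S. The bound on \<open>T n 1\<close> supplies the uniform bound that Simons'
  inequality requires.\<close>

definition sublinear_on :: "'v::real_vector set \<Rightarrow> ('v \<Rightarrow> real) \<Rightarrow> bool" where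
  "sublinear_on E p \<longleftrightarrow> (\<forall>u\<in>E. \<forall>v\<in>E. p (u + v) \<le> p u + p v) \<and>
     (\<forall>u\<in>E. \<forall>c>0. p (c *\<^sub>R u) = c * p u)"

definition functional_on :: "'v::real_vector set \<Rightarrow> ('v \<Rightarrow> real) \<Rightarrow> bool" where
  "functional_on E a \<longleftrightarrow> (\<forall>u\<in>E. \<forall>v\<in>E. a (u + v) = a u + a v) \<and>
     (\<forall>u\<in>E. \<forall>c. a (c *\<^sub>R u) = c * a u)"

text \<open>For \<open>E = contf W\<close> and \<open>p = supw W\<close>, with \<open>W\<close>
  compact and nonempty, these are the integrals against Radon probability measures on
  \<open>W\<close>.\<close>

definition minorant :: "'v::real_vector set \<Rightarrow> ('v \<Rightarrow> real) \<Rightarrow> ('v \<Rightarrow> real) \<Rightarrow> bool" where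
  "minorant E p a \<longleftrightarrow> functional_on E a \<and> (\<forall>u\<in>E. a u \<le> p u)"

definition extreme_minorant :: "'v::real_vector set \<Rightarrow> ('v \<Rightarrow> real) \<Rightarrow> ('v \<Rightarrow> real) \<Rightarrow> bool" where
  "extreme_minorant E p q \<longleftrightarrow> minorant E p q \<and>
     (\<forall>a b t. minorant E p a \<and> minorant E p b \<and> 0 < t \<and> t < 1 \<and>
        (\<forall>u\<in>E. q u = t * a u + (1 - t) * b u) \<longrightarrow> (\<forall>u\<in>E. a u = b u))"

lemma functional_on_zero:
  assumes "functional_on E a" "subspace E"
  shows "a 0 = 0"
proof -
  have "a (0 *\<^sub>R 0) = 0 * a 0"
    using assms unfolding functional_on_def subspace_def by blast
  then show ?thesis by simp
qed

lemma functional_on_uminus: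
  assumes "functional_on E a" "u \<in> E"
  shows "a (- u) = - a u"
proof -
  have "a ((-1) *\<^sub>R u) = (-1) * a u"
    using assms unfolding functional_on_def by blast
  then show ?thesis by simp
qed

lemma functional_on_diff:
  assumes "functional_on E a" "subspace E" "u \<in> E" "v \<in> E"
  shows "a (u - v) = a u - a v"
proof -
  have "a (u + - v) = a u + a (- v)"
    using assms subspace_neg[of E v] unfolding functional_on_def by blast
  then show ?thesis using functional_on_uminus[OF assms(1,4)] by simp
qed

lemma functional_on_sum:
  assumes "functional_on E a" "subspace E" "finite I" "\<And>i. i \<in> I \<Longrightarrow> u i \<in> E"
  shows "a (\<Sum>i\<in>I. u i) = (\<Sum>i\<in>I. a (u i))"
  using assms(3,4)
proof (induction I rule: finite_induct)
  case empty
  then show ?case using functional_on_zero[OF assms(1,2)] by simp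
next
  case (insert i I)
  have "sum u I \<in> E"
    using insert.prems by (intro subspace_sum[OF assms(2)]) auto
  then show ?case
    using insert assms(1) unfolding functional_on_def by auto
qed

lemma sublinear_on_zero:
  assumes "sublinear_on E p" "subspace E"
  shows "p 0 = 0"
proof -
  have "p (2 *\<^sub>R 0) = 2 * p 0"
    using assms unfolding sublinear_on_def subspace_def by (metis zero_less_numeral)
  then show ?thesis by simp
qed

lemma sublinear_on_neg_le:
  assumes "sublinear_on E p" "subspace E" "u \<in> E"
  shows "- p (- u) \<le> p u"
proof -
  have "p (u + - u) \<le> p u + p (- u)"
    using assms subspace_neg[of E u] unfolding sublinear_on_def by blast
  then show ?thesis using sublinear_on_zero[OF assms(1,2)] by simp
qed

text \<open>For \<open>C\<close> a subspace this is the Hahn-Banach extension step; for \<open>C\<close> a ray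
  \<open>{r v | r \<ge> 0}\<close> and \<open>\<tau> = q\<close> it yields the directional derivative of \<open>q\<close> at \<open>v\<close>.\<close>
definition lowered :: "'v::real_vector set \<Rightarrow> ('v \<Rightarrow> real) \<Rightarrow> ('v \<Rightarrow> real) \<Rightarrow> 'v \<Rightarrow> real" where
  "lowered C \<tau> q u = (INF e\<in>C. q (u + e) - \<tau> e)"

text \<open>\<open>C\<close> is a convex cone and not necessarily a subspace, so that one
  construction serves both uses. The domination of \<open>\<tau>\<close> by \<open>q\<close> is what
  keeps the infimum in \<open>lowered\<close> bounded below.\<close>

definition lowerable :: "'v::real_vector set \<Rightarrow> ('v \<Rightarrow> real) \<Rightarrow> 'v set \<Rightarrow> ('v \<Rightarrow> real) \<Rightarrow> bool" where
  "lowerable E q C \<tau> \<longleftrightarrow> subspace E \<and> sublinear_on E q \<and> C \<subseteq> E \<and> 0 \<in> C \<and>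
     (\<forall>e\<in>C. \<forall>e'\<in>C. e + e' \<in> C \<and> \<tau> (e + e') = \<tau> e + \<tau> e') \<and>
     (\<forall>e\<in>C. \<forall>c>0. c *\<^sub>R e \<in> C \<and> \<tau> (c *\<^sub>R e) = c * \<tau> e) \<and> (\<forall>e\<in>C. \<tau> e \<le> q e)"

text \<open>The infimum is finite because subadditivity bounds every term below by
  \<open>- q (- u)\<close>. The purpose of \<open>lowered_neg\<close> is that a linear minorant
  \<open>a\<close> of the lowered functional satisfies \<open>a (- e) \<le> - \<tau> e\<close>, that
  is, \<open>a e \<ge> \<tau> e\<close> on \<open>C\<close>.\<close>

lemma
  fixes E :: "'v::real_vector set"
  assumes lowerable: "lowerable E q C \<tau>"
  shows lowered_le_self: "\<And>u. u \<in> E \<Longrightarrow> lowered C \<tau> q u \<le> q u"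
    and lowered_neg: "\<And>e. e \<in> C \<Longrightarrow> lowered C \<tau> q (- e) \<le> - \<tau> e"
    and sublinear_on_lowered: "sublinear_on E (lowered C \<tau> q)"
proof -
  have E: "subspace E" and q: "sublinear_on E q" and C: "C \<subseteq> E" "0 \<in> C"
    "\<And>e e'. e \<in> C \<Longrightarrow> e' \<in> C \<Longrightarrow> e + e' \<in> C" "\<And>e c. e \<in> C \<Longrightarrow> 0 < c \<Longrightarrow> c *\<^sub>R e \<in> C"
    and \<tau>: "\<And>e c. e \<in> C \<Longrightarrow> 0 < c \<Longrightarrow> \<tau> (c *\<^sub>R e) = c * \<tau> e"
      "\<And>e e'. e \<in> C \<Longrightarrow> e' \<in> C \<Longrightarrow> \<tau> (e + e') = \<tau> e + \<tau> e'"
    and le: "\<And>e. e \<in> C \<Longrightarrow> \<tau> e \<le> q e"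
    using lowerable unfolding lowerable_def by auto
  have \<tau>0: "\<tau> 0 = 0"
    using \<tau>(2)[OF C(2) C(2)] by simp
  have q0: "q 0 = 0"
    using sublinear_on_zero[OF q E] .
  have bdd: "bdd_below ((\<lambda>e. q (u + e) - \<tau> e) ` C)" if "u \<in> E" for u
  proof (rule bdd_belowI2)
    fix e assume e: "e \<in> C"
    have "q ((u + e) + (- u)) \<le> q (u + e) + q (- u)"
      using q that e C(1) E unfolding sublinear_on_def
      by (meson subsetD subspace_add subspace_neg)
    then show "- q (- u) \<le> q (u + e) - \<tau> e"
      using le[OF e] by simp
  qed
  have le1: "lowered C \<tau> q u \<le> q (u + e) - \<tau> e" if "u \<in> E" "e \<in> C" for u e
    unfolding lowered_def using bdd[OF that(1)] that(2) by (rule cINF_lower)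
  show "lowered C \<tau> q u \<le> q u" if "u \<in> E" for u
    using le1[OF that C(2)] \<tau>0 by simp
  show "lowered C \<tau> q (- e) \<le> - \<tau> e" if "e \<in> C" for e
    using le1[of "- e" e] that C(1) E q0 by (auto simp: subspace_neg)
  have scale: "lowered C \<tau> q (c *\<^sub>R u) \<le> c * lowered C \<tau> q u" if u: "u \<in> E" and c: "c > 0" for u c
  proof -
    have "inverse c * lowered C \<tau> q (c *\<^sub>R u) \<le> lowered C \<tau> q u"
      unfolding lowered_def[of C \<tau> q u]
    proof (rule cINF_greatest)
      show "C \<noteq> {}" using C(2) by auto
      fix e assume e: "e \<in> C"
      have "lowered C \<tau> q (c *\<^sub>R u) \<le> q (c *\<^sub>R u + c *\<^sub>R e) - \<tau> (c *\<^sub>R e)"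
        using le1[of "c *\<^sub>R u" "c *\<^sub>R e"] C(4)[OF e c] u E by (simp add: subspace_scale)
      also have "q (c *\<^sub>R u + c *\<^sub>R e) = c * q (u + e)"
        using q c u e C(1) E unfolding sublinear_on_def
        by (metis scaleR_right_distrib subsetD subspace_add)
      also have "\<tau> (c *\<^sub>R e) = c * \<tau> e"
        using \<tau>(1) e c by blast
      finally show "inverse c * lowered C \<tau> q (c *\<^sub>R u) \<le> q (u + e) - \<tau> e"
        using c by (simp add: field_simps)
    qed
    then show ?thesis using c by (simp add: field_simps)
  qed
  show "sublinear_on E (lowered C \<tau> q)"
    unfolding sublinear_on_def
  proof (intro conjI ballI allI impI)
    fix u v assume u: "u \<in> E" and v: "v \<in> E"
    have ne: "C \<noteq> {}" using C(2) by auto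
    have *: "lowered C \<tau> q (u + v) \<le> (q (u + e) - \<tau> e) + (q (v + e') - \<tau> e')"
      if e: "e \<in> C" "e' \<in> C" for e e'
    proof -
      have "lowered C \<tau> q (u + v) \<le> q (u + v + (e + e')) - \<tau> (e + e')"
        using u v e C(3) E by (intro le1) (auto simp: subspace_add)
      also have "u + v + (e + e') = (u + e) + (v + e')" by simp
      also have "q \<dots> \<le> q (u + e) + q (v + e')"
        using q u v e C(1) E unfolding sublinear_on_def by (meson subsetD subspace_add)
      finally show ?thesis using \<tau>(2)[OF e] by simp
    qed
    have "lowered C \<tau> q (u + v) - lowered C \<tau> q v \<le> q (u + e) - \<tau> e" if e: "e \<in> C" for e
    proof -
      have "lowered C \<tau> q (u + v) - (q (u + e) - \<tau> e) \<le> lowered C \<tau> q v"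
        unfolding lowered_def[of C \<tau> q v] using *[OF e] by (intro cINF_greatest ne) (simp add: algebra_simps)
      then show ?thesis by simp
    qed
    then have "lowered C \<tau> q (u + v) - lowered C \<tau> q v \<le> lowered C \<tau> q u"
      unfolding lowered_def[of C \<tau> q u] by (intro cINF_greatest ne)
    then show "lowered C \<tau> q (u + v) \<le> lowered C \<tau> q u + lowered C \<tau> q v" by simp
  next
    fix u :: 'v and c :: real assume u: "u \<in> E" and c: "0 < c"
    have "lowered C \<tau> q (inverse c *\<^sub>R c *\<^sub>R u) \<le> inverse c * lowered C \<tau> q (c *\<^sub>R u)"
      using u c E by (intro scale) (auto simp: subspace_scale)
    then have "c * lowered C \<tau> q u \<le> lowered C \<tau> q (c *\<^sub>R u)"
      using c by (simp add: field_simps)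
    with scale[OF u c] show "lowered C \<tau> q (c *\<^sub>R u) = c * lowered C \<tau> q u" by simp
  qed
qed

section \<open>Directional derivatives and faces of the set of minorants\<close>

definition ray :: "'v::real_vector \<Rightarrow> 'v set" where
  "ray v = (\<lambda>r. r *\<^sub>R v) ` {0..}"

lemma self_mem_ray: "v \<in> ray v"
  unfolding ray_def by (rule image_eqI[of _ _ 1]) auto

text \<open>A half-line rather than a line: positive homogeneity alone makes \<open>q\<close>
  additive on it, so \<open>\<tau> = q\<close> is admissible.\<close>

lemma lowerable_ray:
  assumes E: "subspace E" and q: "sublinear_on E q" and v: "v \<in> E"
  shows "lowerable E q (ray v) q"
proof -
  have q0: "q 0 = 0" using sublinear_on_zero[OF q E] .
  have qr: "q (r *\<^sub>R v) = r * q v" if "r \<ge> 0" for r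
  proof (cases "r = 0")
    case True
    then show ?thesis using q0 by simp
  next
    case False
    then show ?thesis using that q v unfolding sublinear_on_def by auto
  qed
  have add: "r *\<^sub>R v + s *\<^sub>R v \<in> ray v \<and> q (r *\<^sub>R v + s *\<^sub>R v) = q (r *\<^sub>R v) + q (s *\<^sub>R v)"
    if "r \<ge> 0" "s \<ge> 0" for r s
    using that qr[of "r + s"] qr[of r] qr[of s]
    by (auto simp: ray_def scaleR_left_distrib[symmetric] distrib_right)
  have scale: "c *\<^sub>R r *\<^sub>R v \<in> ray v \<and> q (c *\<^sub>R r *\<^sub>R v) = c * q (r *\<^sub>R v)"
    if "r \<ge> 0" "c > 0" for r c
    using that qr[of "c * r"] qr[of r] by (auto simp: ray_def)
  have "\<forall>e\<in>ray v. \<forall>e'\<in>ray v. e + e' \<in> ray v \<and> q (e + e') = q e + q e'"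
    using add unfolding ray_def by auto
  moreover have "\<forall>e\<in>ray v. \<forall>c>0. c *\<^sub>R e \<in> ray v \<and> q (c *\<^sub>R e) = c * q e"
    using scale unfolding ray_def by auto
  moreover have "ray v \<subseteq> E" using E v by (auto simp: ray_def subspace_scale)
  moreover have "0 \<in> ray v" unfolding ray_def by (rule image_eqI[of _ _ 0]) auto
  ultimately show ?thesis
    unfolding lowerable_def using E q by blast
qed

text \<open>A minorant touching \<open>q\<close> at \<open>v\<close> touches it along the whole ray,
  so subtracting \<open>a e = q e\<close> from \<open>a (u + e) \<le> q (u + e)\<close> gives the
  bound. Together with \<open>lowered_neg\<close>, the lowered functional cuts out exactly the face
  of minorants that touch \<open>q\<close> at \<open>v\<close>.\<close>

lemma minorant_le_lowered_ray:
  assumes E: "subspace E" and q: "sublinear_on E q" and v: "v \<in> E"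
    and a: "minorant E q a" "a v = q v" and u: "u \<in> E"
  shows "a u \<le> lowered (ray v) q q u"
  unfolding lowered_def
proof (rule cINF_greatest)
  show "ray v \<noteq> {}" using self_mem_ray by blast
  fix e assume e: "e \<in> ray v"
  then obtain r where r: "r \<ge> 0" "e = r *\<^sub>R v" by (auto simp: ray_def)
  have eE: "e \<in> E" using r v E by (simp add: subspace_scale)
  have "a e = r * q v"
    using a v r unfolding minorant_def functional_on_def by auto
  also have "\<dots> \<ge> q e"
  proof (cases "r = 0")
    case True
    then show ?thesis using r sublinear_on_zero[OF q E] by simp
  next
    case False
    then show ?thesis using r q v unfolding sublinear_on_def by auto
  qed
  finally have "q e \<le> a e" .
  moreover have "a u + a e \<le> q (u + e)"
    using a(1) u eE E unfolding minorant_def functional_on_def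
    by (metis subspace_add)
  ultimately show "a u \<le> q (u + e) - q e" by simp
qed

text \<open>A Zorn-minimal element among the sublinear functionals cutting out faces of the set of linear
  minorants of \<open>p\<close> is linear, since it coincides with all of its directional derivatives.\<close>
definition facial :: "'v::real_vector set \<Rightarrow> ('v \<Rightarrow> real) \<Rightarrow> ('v \<Rightarrow> real) \<Rightarrow> bool" where
  "facial E p q \<longleftrightarrow> sublinear_on E q \<and> (\<forall>u\<in>E. q u \<le> p u) \<and>
     (\<forall>a b t. minorant E p a \<and> minorant E p b \<and> 0 < t \<and> t < 1 \<and>
        (\<forall>u\<in>E. t * a u + (1 - t) * b u \<le> q u) \<longrightarrow> minorant E q a \<and> minorant E q b)"

text \<open>If a proper mean of \<open>a\<close> and \<open>b\<close> lies below the derivative,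
  evaluating at \<open>- v\<close> shows that the mean is at least \<open>q v\<close> at
  \<open>v\<close>. Neither \<open>a v\<close> nor \<open>b v\<close> exceeds \<open>q v\<close>, so
  both equal it and both lie in the smaller face.\<close>

lemma facial_lowered_ray:
  assumes E: "subspace E" and q: "facial E p q" and v: "v \<in> E"
  shows "facial E p (lowered (ray v) q q)"
proof -
  have sq: "sublinear_on E q" using q by (simp add: facial_def)
  note low = lowerable_ray[OF E sq v]
  note lw = lowered_le_self[OF low] lowered_neg[OF low] sublinear_on_lowered[OF low]
  show ?thesis
    unfolding facial_def
  proof (intro conjI allI impI ballI)
    show "sublinear_on E (lowered (ray v) q q)" using lw(3) .
    fix u assume "u \<in> E"
    then show "lowered (ray v) q q u \<le> p u"
      using lw(1)[of u] q unfolding facial_def by fastforce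
  next
    fix a b t
    assume H: "minorant E p a \<and> minorant E p b \<and> 0 < t \<and> t < 1 \<and>
       (\<forall>u\<in>E. t * a u + (1 - t) * b u \<le> lowered (ray v) q q u)"
    then have "\<forall>u\<in>E. t * a u + (1 - t) * b u \<le> q u"
      using lw(1) by fastforce
    then have mq: "minorant E q a" "minorant E q b"
      using H q unfolding facial_def by blast+
    have fa: "functional_on E a" "functional_on E b"
      using H by (auto simp: minorant_def)
    have "t * a (- v) + (1 - t) * b (- v) \<le> - q v"
      using H lw(2)[OF self_mem_ray] v E by (meson order.trans subspace_neg)
    then have ge: "q v \<le> t * a v + (1 - t) * b v"
      using functional_on_uminus[OF fa(1) v] functional_on_uminus[OF fa(2) v] by simp
    have le: "a v \<le> q v" "b v \<le> q v"
      using mq v by (auto simp: minorant_def)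
    have "t * (q v - a v) + (1 - t) * (q v - b v) \<le> 0"
      using ge by (simp add: algebra_simps)
    moreover have "t * (q v - a v) \<ge> 0" "(1 - t) * (q v - b v) \<ge> 0"
      using le H by auto
    ultimately have "t * (q v - a v) = 0" "(1 - t) * (q v - b v) = 0"
      by linarith+
    then have "a v = q v" "b v = q v"
      using H by auto
    then show "minorant E (lowered (ray v) q q) a" "minorant E (lowered (ray v) q q) b"
      using minorant_le_lowered_ray[OF E sq v] mq
      unfolding minorant_def by blast+
  qed
qed

text \<open>The members are bounded below by \<open>- p (- u)\<close>, so the infimum is finite.
  Subadditivity needs the chain: for \<open>q u + r v\<close>, the smaller of \<open>q\<close> and
  \<open>r\<close> can be used at both points.\<close>

lemma facial_Inf_chain:
  fixes p :: "'v::real_vector \<Rightarrow> real"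
  assumes E: "subspace E" and C: "C \<noteq> {}" "\<And>q. q \<in> C \<Longrightarrow> facial E p q"
    and chain: "\<And>q r. q \<in> C \<Longrightarrow> r \<in> C \<Longrightarrow> (\<forall>u\<in>E. q u \<le> r u) \<or> (\<forall>u\<in>E. r u \<le> q u)"
  shows "facial E p (\<lambda>u. INF q\<in>C. q u)" (is "facial E p ?Q")
    and "\<And>q u. q \<in> C \<Longrightarrow> u \<in> E \<Longrightarrow> (INF q\<in>C. q u) \<le> q u"
proof -
  have bdd: "bdd_below ((\<lambda>q. q u) ` C)" if u: "u \<in> E" for u
  proof (rule bdd_belowI2)
    fix q assume "q \<in> C"
    then have q: "facial E p q" using C by auto
    have "- q (- u) \<le> q u"
      using q u E by (intro sublinear_on_neg_le[of E]) (auto simp: facial_def)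
    moreover have "q (- u) \<le> p (- u)"
      using q u E by (auto simp: facial_def subspace_neg)
    ultimately show "- p (- u) \<le> q u" by simp
  qed
  show le: "?Q u \<le> q u" if "q \<in> C" "u \<in> E" for q u
    using bdd[OF that(2)] that(1) by (rule cINF_lower)
  obtain q0 where q0: "q0 \<in> C" using C by auto
  show "facial E p ?Q"
    unfolding facial_def
  proof (intro conjI ballI allI impI)
    show "sublinear_on E ?Q"
      unfolding sublinear_on_def
    proof (intro conjI ballI allI impI)
      fix u v assume u: "u \<in> E" and v: "v \<in> E"
      have uv: "u + v \<in> E" using u v E by (simp add: subspace_add)
      have *: "?Q (u + v) \<le> q u + r v" if qr: "q \<in> C" "r \<in> C" for q r
      proof -
        have sub: "q (u + v) \<le> q u + q v" "r (u + v) \<le> r u + r v"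
          using C(2)[OF qr(1)] C(2)[OF qr(2)] u v
          by (auto simp: facial_def sublinear_on_def)
        show ?thesis
          using chain[OF qr] sub le[OF qr(1) uv] le[OF qr(2) uv] u v by fastforce
      qed
      have "?Q (u + v) - ?Q v \<le> q u" if q: "q \<in> C" for q
      proof -
        have "?Q (u + v) - q u \<le> ?Q v"
          using *[OF q] C(1) by (intro cINF_greatest) (auto simp: algebra_simps)
        then show ?thesis by simp
      qed
      then have "?Q (u + v) - ?Q v \<le> ?Q u"
        using C(1) by (intro cINF_greatest)
      then show "?Q (u + v) \<le> ?Q u + ?Q v" by simp
    next
      fix u and c :: real assume u: "u \<in> E" and c: "0 < c"
      have cu: "c *\<^sub>R u \<in> E" using u E by (simp add: subspace_scale)
      have hom: "q (c *\<^sub>R u) = c * q u" if "q \<in> C" for q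
        using C(2)[OF that] u c by (auto simp: facial_def sublinear_on_def)
      have "c * ?Q u \<le> ?Q (c *\<^sub>R u)"
      proof (rule cINF_greatest[OF C(1)])
        fix q assume q: "q \<in> C"
        show "c * ?Q u \<le> q (c *\<^sub>R u)"
          using le[OF q u] hom[OF q] c by simp
      qed
      moreover have "inverse c * ?Q (c *\<^sub>R u) \<le> ?Q u"
      proof (rule cINF_greatest[OF C(1)])
        fix q assume q: "q \<in> C"
        show "inverse c * ?Q (c *\<^sub>R u) \<le> q u"
          using le[OF q cu] hom[OF q] c by (simp add: field_simps)
      qed
      ultimately show "?Q (c *\<^sub>R u) = c * ?Q u"
        using c by (simp add: field_simps)
    qed
  next
    fix u assume u: "u \<in> E"
    show "?Q u \<le> p u"
      using le[OF q0 u] C(2)[OF q0] u by (force simp: facial_def)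
  next
    fix a b t
    assume H: "minorant E p a \<and> minorant E p b \<and> 0 < t \<and> t < 1 \<and>
       (\<forall>u\<in>E. t * a u + (1 - t) * b u \<le> ?Q u)"
    have m: "minorant E q a \<and> minorant E q b" if q: "q \<in> C" for q
    proof -
      have "\<forall>u\<in>E. t * a u + (1 - t) * b u \<le> q u"
        using H le[OF q] by fastforce
      then show ?thesis using H C(2)[OF q] unfolding facial_def by blast
    qed
    show "minorant E ?Q a" "minorant E ?Q b"
      using m C(1) H unfolding minorant_def by (auto intro!: cINF_greatest)
  qed
qed

text \<open>The substitute for the Krein-Milman theorem: an extreme point of the face of minorants
  whose value at \<open>v\<close> is maximal.\<close>

theorem exists_extreme_minorant:
  fixes p :: "'v::real_vector \<Rightarrow> real"
  assumes E: "subspace E" and p: "sublinear_on E p" and v: "v \<in> E"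
  obtains q where "extreme_minorant E p q" "q v = p v"
proof -
  \<comment> \<open>Values outside \<open>E\<close> carry no information; setting them to 0 makes
    the order on \<open>E\<close> antisymmetric, as Zorn's lemma requires.\<close>
  define cut where "cut q = (\<lambda>u. if u \<in> E then q u else 0)" for q :: "'v \<Rightarrow> real"
  have cut_facial: "facial E p (cut q) = facial E p q" for q
  proof -
    have 1: "sublinear_on E (cut q) = sublinear_on E q"
      using E unfolding sublinear_on_def cut_def by (simp add: subspace_add subspace_scale)
    have 2: "minorant E (cut q) a = minorant E q a" for a
      unfolding minorant_def cut_def by simp
    show ?thesis unfolding facial_def 1 2 by (simp add: cut_def)
  qed
  have facial_p: "facial E p p"
    unfolding facial_def using p by blast
  note low = lowerable_ray[OF E p v]
  \<comment> \<open>Starting below the derivative along \<open>v\<close> forces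
    \<open>q (- v) \<le> - p v\<close>, hence \<open>q v = p v\<close> once \<open>q\<close> is
    known to be linear.\<close>
  define p1 where "p1 = lowered (ray v) p p"
  have p1: "facial E p p1" unfolding p1_def by (rule facial_lowered_ray[OF E facial_p v])
  have p1v: "p1 (- v) \<le> - p v"
    unfolding p1_def using lowered_neg[OF low self_mem_ray] .
  define A where "A = {q. facial E p q \<and> cut q = q \<and> (\<forall>u\<in>E. q u \<le> p1 u)}"
  \<comment> \<open>The order is reversed, so that a maximal element in Zorn's lemma is a minimal
    functional.\<close>
  define P where "P = (\<lambda>q r :: 'v \<Rightarrow> real. \<forall>u\<in>E. r u \<le> q u)"
  have cut_idem: "cut (cut q) = cut q" for q by (auto simp: cut_def fun_eq_iff)
  have "\<exists>m\<in>A. \<forall>a\<in>A. P m a \<longrightarrow> a = m"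
  proof (rule predicate_Zorn)
    have antisym: "q = r" if qr: "q \<in> A" "r \<in> A" "P q r" "P r q" for q r
    proof
      fix u show "q u = r u"
      proof (cases "u \<in> E")
        case True
        then show ?thesis using qr(3,4) by (force simp: P_def)
      next
        case False
        then have "cut q u = 0" "cut r u = 0" by (auto simp: cut_def)
        then show ?thesis using qr(1,2) by (simp add: A_def)
      qed
    qed
    show "partial_order_on A (relation_of P A)"
      by (rule partial_order_on_relation_ofI) (use antisym in \<open>auto simp: P_def intro: order.trans\<close>)
  next
    fix C assume "C \<in> Chains (relation_of P A)"
    then have CA: "C \<subseteq> A" and chain: "\<And>q r. q \<in> C \<Longrightarrow> r \<in> C \<Longrightarrow> P q r \<or> P r q"
      unfolding Chains_def relation_of_def by blast+
    show "\<exists>u\<in>A. \<forall>a\<in>C. P a u"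
    proof (cases "C = {}")
      case True
      have "cut p1 \<in> A" using p1 by (auto simp: A_def cut_facial cut_idem) (auto simp: cut_def)
      then show ?thesis using True by blast
    next
      case False
      define Q where "Q u = (INF q\<in>C. q u)" for u
      have Q: "facial E p Q" "\<And>q u. q \<in> C \<Longrightarrow> u \<in> E \<Longrightarrow> Q u \<le> q u"
        unfolding Q_def
        using facial_Inf_chain[OF E False, of p] CA chain by (auto simp: A_def P_def)
      obtain q0 where q0: "q0 \<in> C" using False by auto
      have "\<forall>u\<in>E. Q u \<le> p1 u"
        using Q(2)[OF q0] q0 CA by (force simp: A_def)
      then have "cut Q \<in> A"
        using Q(1) by (auto simp: A_def cut_facial cut_idem) (auto simp: cut_def)
      moreover have "\<forall>q\<in>C. P q (cut Q)"
        using Q(2) by (auto simp: P_def cut_def)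
      ultimately show ?thesis by blast
    qed
  qed
  then obtain q where qA: "q \<in> A" and min: "\<And>r. r \<in> A \<Longrightarrow> P q r \<Longrightarrow> r = q" by blast
  have q: "facial E p q" using qA by (simp add: A_def)
  have sq: "sublinear_on E q" using q by (simp add: facial_def)
  \<comment> \<open>By minimality \<open>q\<close> equals its derivative along \<open>w\<close>, and
    that derivative is at most \<open>- q w\<close> at \<open>- w\<close>. So \<open>q\<close> is
    odd, and an odd sublinear functional is linear.\<close>
  have neg: "q (- w) = - q w" if w: "w \<in> E" for w
  proof -
    note low = lowerable_ray[OF E sq w]
    define r where "r = lowered (ray w) q q"
    have rle: "r u \<le> q u" if "u \<in> E" for u
      unfolding r_def using lowered_le_self[OF low] that by blast
    have "facial E p r" unfolding r_def by (rule facial_lowered_ray[OF E q w])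
    then have "cut r \<in> A"
      using rle qA by (auto simp: A_def cut_facial cut_idem) (force simp: cut_def)
    moreover have "P q (cut r)" using rle by (simp add: P_def cut_def)
    ultimately have "cut r = q" by (rule min)
    then have "r (- w) = q (- w)"
      using w E by (metis cut_def subspace_neg)
    moreover have "r (- w) \<le> - q w"
      unfolding r_def using lowered_neg[OF low self_mem_ray] .
    moreover have "- q (- w) \<le> q w"
      by (rule sublinear_on_neg_le[OF sq E w])
    ultimately show ?thesis by simp
  qed
  have fq: "functional_on E q"
    unfolding functional_on_def
  proof (intro conjI ballI allI)
    fix u w assume uw: "u \<in> E" "w \<in> E"
    have "q (- u + - w) \<le> q (- u) + q (- w)"
      using sq uw E unfolding sublinear_on_def by (meson subspace_neg)
    then have "- q (u + w) \<le> - q u + - q w"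
      using neg[of u] neg[of w] neg[of "u + w"] uw E by (simp add: subspace_add)
    moreover have "q (u + w) \<le> q u + q w"
      using sq uw unfolding sublinear_on_def by blast
    ultimately show "q (u + w) = q u + q w" by simp
  next
    fix u and c :: real assume u: "u \<in> E"
    have pos: "q (c *\<^sub>R w) = c * q w" if "c > 0" "w \<in> E" for c w
      using sq that unfolding sublinear_on_def by blast
    consider "c > 0" | "c = 0" | "c < 0" by linarith
    then show "q (c *\<^sub>R u) = c * q u"
    proof cases
      case 3
      have "q (c *\<^sub>R u) = q ((- c) *\<^sub>R (- u))" by simp
      also have "\<dots> = (- c) * q (- u)"
        using 3 u E by (intro pos) (auto simp: subspace_neg)
      finally show ?thesis using neg[OF u] by simp
    qed (use pos u sublinear_on_zero[OF sq E] in auto)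
  qed
  have qp: "q u \<le> p u" if "u \<in> E" for u
    using q that by (simp add: facial_def)
  show thesis
  proof (rule that)
    have "q (- v) \<le> p1 (- v)"
      using qA v E by (simp add: A_def subspace_neg)
    then show "q v = p v"
      using p1v neg[OF v] qp[OF v] by simp
    show "extreme_minorant E p q"
      unfolding extreme_minorant_def
    proof (intro conjI allI impI)
      show "minorant E p q" using fq qp by (simp add: minorant_def)
      fix a b t
      assume H: "minorant E p a \<and> minorant E p b \<and> 0 < t \<and> t < 1 \<and>
        (\<forall>u\<in>E. q u = t * a u + (1 - t) * b u)"
      then have m: "minorant E q a" "minorant E q b"
        using q unfolding facial_def by (metis order.refl)+
      \<comment> \<open>A linear functional below a linear functional equals it, so the face cut out
        by \<open>q\<close> is the single point \<open>q\<close>.\<close>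
      have eq: "a u = q u" if a: "minorant E q a" and u: "u \<in> E" for a u
      proof -
        have "a (- u) \<le> q (- u)" "a u \<le> q u"
          using a u E by (auto simp: minorant_def subspace_neg)
        moreover have "a (- u) = - a u"
          using a u by (intro functional_on_uminus[of E]) (auto simp: minorant_def)
        ultimately show ?thesis using neg[OF u] by simp
      qed
      show "\<forall>u\<in>E. a u = b u" using eq[OF m(1)] eq[OF m(2)] by simp
    qed
  qed
qed

text \<open>The prescribed value at \<open>v\<close> is the largest that an extension of
  \<open>q\<close> below \<open>p\<close> can take there, since
  \<open>\<mu> v = \<mu> (v + e) - q e \<le> p (v + e) - q e\<close>. This is what later turns
  uniqueness of the extension into an approximation from above.\<close>

lemma hahn_banach_minorant:
  assumes V: "subspace V" and p: "sublinear_on V p"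
    and E: "subspace E" "E \<subseteq> V" and q: "minorant E p q" and v: "v \<in> V"
  obtains \<mu> where "minorant V p \<mu>" "\<And>e. e \<in> E \<Longrightarrow> \<mu> e = q e" "\<mu> v = lowered E q p v"
proof -
  have fq: "functional_on E q" and le: "\<And>e. e \<in> E \<Longrightarrow> q e \<le> p e"
    using q by (auto simp: minorant_def)
  have add: "\<And>e e'. e \<in> E \<Longrightarrow> e' \<in> E \<Longrightarrow> q (e + e') = q e + q e'"
    using fq by (simp add: functional_on_def)
  have low: "lowerable V p E q"
    using V p E fq le unfolding lowerable_def functional_on_def
    by (auto simp: subspace_0 subspace_add subspace_scale)
  have sub: "sublinear_on V (lowered E q p)"
    by (rule sublinear_on_lowered[OF low])
  obtain \<mu> where ext: "extreme_minorant V (lowered E q p) \<mu>" and \<mu>v: "\<mu> v = lowered E q p v"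
    using exists_extreme_minorant[OF V sub v] by blast
  have \<mu>: "minorant V (lowered E q p) \<mu>" using ext by (simp add: extreme_minorant_def)
  have f\<mu>: "functional_on V \<mu>" using \<mu> by (simp add: minorant_def)
  have "minorant V p \<mu>"
    using \<mu> lowered_le_self[OF low] unfolding minorant_def by fastforce
  moreover have "\<mu> e = q e" if e: "e \<in> E" for e
  proof -
    have le1: "q e \<le> \<mu> e" if e: "e \<in> E" for e
    proof -
      have eV: "e \<in> V" using e E by auto
      have "\<mu> (- e) \<le> lowered E q p (- e)"
        using \<mu> eV V by (auto simp: minorant_def subspace_neg)
      also have "\<dots> \<le> - q e" using lowered_neg[OF low] e by blast
      finally show ?thesis using functional_on_uminus[OF f\<mu> eV] by simp
    qed
    have "q (- e) \<le> \<mu> (- e)" using le1 e E(1) by (simp add: subspace_neg)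
    then show ?thesis
      using le1[OF e] functional_on_uminus[OF f\<mu>, of e] functional_on_uminus[OF fq e] e E(2) by auto
  qed
  ultimately show thesis using that \<mu>v by blast
qed

section \<open>Boundaries of spaces of continuous functions\<close>

instantiation "fun" :: (type, real_vector) real_vector
begin

definition "c *\<^sub>R f = (\<lambda>x. c *\<^sub>R f x)"

instance
  by standard (simp_all add: scaleR_fun_def fun_eq_iff algebra_simps)

end

lemma scaleR_fun_apply [simp]: "(c *\<^sub>R f) x = c *\<^sub>R f x"
  by (simp add: scaleR_fun_def)

definition contf :: "'w::topological_space set \<Rightarrow> ('w \<Rightarrow> real) set" where
  "contf W = {f. continuous_on W f}"

text \<open>No absolute value: a minorant of this supremum on \<open>contf W\<close> is
  automatically positive and fixes constants, while the norm would only bound its size.\<close>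

definition supw :: "'w set \<Rightarrow> ('w \<Rightarrow> real) \<Rightarrow> real" where
  "supw W f = (SUP w\<in>W. f w)"

text \<open>The Choquet boundary of a real function space, with the supremum in place of the
  norm.\<close>

definition extreme_pt :: "'w set \<Rightarrow> ('w \<Rightarrow> real) set \<Rightarrow> 'w \<Rightarrow> bool" where
  "extreme_pt W E w \<longleftrightarrow> w \<in> W \<and> extreme_minorant E (supw W) (\<lambda>f. f w)"

text \<open>Introduced because the infinite averages in \<open>simons_boundary\<close> need not stay
  in \<open>E\<close>.\<close>

definition uniform_closure :: "'w set \<Rightarrow> ('w \<Rightarrow> real) set \<Rightarrow> ('w \<Rightarrow> real) set" where
  "uniform_closure W E = {f. \<forall>e>0. \<exists>g\<in>E. \<forall>w\<in>W. \<bar>f w - g w\<bar> \<le> e}"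

lemma extreme_minorantD:
  assumes "extreme_minorant E p q" "minorant E p a" "minorant E p b" "0 < t" "t < 1"
    "\<And>u. u \<in> E \<Longrightarrow> q u = t * a u + (1 - t) * b u"
  shows "\<forall>u\<in>E. a u = b u"
  using assms unfolding extreme_minorant_def by blast

lemma subspace_contf: "subspace (contf W)"
  unfolding subspace_def contf_def
  by (auto simp: plus_fun_def zero_fun_def scaleR_fun_def intro!: continuous_intros)

lemma subset_uniform_closure: "E \<subseteq> uniform_closure W E"
  unfolding uniform_closure_def by (auto intro!: bexI)

lemma uniform_closure_idem:
  assumes f: "\<And>e. e > 0 \<Longrightarrow> \<exists>g\<in>uniform_closure W E. \<forall>w\<in>W. \<bar>f w - g w\<bar> \<le> e"
  shows "f \<in> uniform_closure W E"
  unfolding uniform_closure_def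
proof (clarsimp)
  fix e :: real assume e: "e > 0"
  obtain g where g: "g \<in> uniform_closure W E" "\<forall>w\<in>W. \<bar>f w - g w\<bar> \<le> e/2"
    using f[of "e/2"] e by auto
  obtain h where h: "h \<in> E" "\<forall>w\<in>W. \<bar>g w - h w\<bar> \<le> e/2"
    using g(1) e unfolding uniform_closure_def by (auto dest!: spec[of _ "e/2"])
  have "\<bar>f w - h w\<bar> \<le> e" if "w \<in> W" for w
    using g(2)[rule_format, OF that] h(2)[rule_format, OF that] by linarith
  then show "\<exists>g\<in>E. \<forall>w\<in>W. \<bar>f w - g w\<bar> \<le> e" using h(1) by blast
qed

lemma subspace_uniform_closure:
  assumes E: "subspace E"
  shows "subspace (uniform_closure W E)"
  unfolding subspace_def
proof (intro conjI ballI allI)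
  show "0 \<in> uniform_closure W E"
    using subset_uniform_closure[of E W] subspace_0[OF E] by auto
  fix f assume f: "f \<in> uniform_closure W E"
  show "c *\<^sub>R f \<in> uniform_closure W E" for c :: real
    unfolding uniform_closure_def
  proof (clarsimp)
    fix e :: real assume e: "e > 0"
    obtain g where g: "g \<in> E" "\<forall>w\<in>W. \<bar>f w - g w\<bar> \<le> e / (\<bar>c\<bar> + 1)"
      using f e unfolding uniform_closure_def by (auto dest!: spec[of _ "e / (\<bar>c\<bar> + 1)"])
    have "\<bar>c * f w - (c *\<^sub>R g) w\<bar> \<le> e" if w: "w \<in> W" for w
    proof -
      have "\<bar>c * f w - (c *\<^sub>R g) w\<bar> = \<bar>c\<bar> * \<bar>f w - g w\<bar>"
        by (simp add: abs_mult[symmetric] algebra_simps)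
      also have "\<dots> \<le> (\<bar>c\<bar> + 1) * (e / (\<bar>c\<bar> + 1))"
        using g(2) w by (intro mult_mono) auto
      also have "\<dots> = e" by simp
      finally show ?thesis .
    qed
    moreover have "c *\<^sub>R g \<in> E" using g(1) E by (simp add: subspace_scale)
    ultimately show "\<exists>g\<in>E. \<forall>w\<in>W. \<bar>c * f w - g w\<bar> \<le> e" by blast
  qed
  fix f' assume f': "f' \<in> uniform_closure W E"
  show "f + f' \<in> uniform_closure W E"
    unfolding uniform_closure_def
  proof (clarsimp)
    fix e :: real assume e: "e > 0"
    obtain g where g: "g \<in> E" "\<forall>w\<in>W. \<bar>f w - g w\<bar> \<le> e/2"
      using f e unfolding uniform_closure_def by (auto dest!: spec[of _ "e/2"])
    obtain g' where g': "g' \<in> E" "\<forall>w\<in>W. \<bar>f' w - g' w\<bar> \<le> e/2"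
      using f' e unfolding uniform_closure_def by (auto dest!: spec[of _ "e/2"])
    have "\<bar>f w + f' w - (g + g') w\<bar> \<le> e" if "w \<in> W" for w
      using g(2)[rule_format, OF that] g'(2)[rule_format, OF that] unfolding plus_fun_apply by linarith
    moreover have "g + g' \<in> E" using g(1) g'(1) E by (simp add: subspace_add)
    ultimately show "\<exists>g\<in>E. \<forall>w\<in>W. \<bar>f w + f' w - g w\<bar> \<le> e" by blast
  qed
qed

lemma uniform_closure_contf:
  assumes "E \<subseteq> contf W"
  shows "uniform_closure W E \<subseteq> contf W"
proof
  fix f assume f: "f \<in> uniform_closure W E"
  have "\<forall>n. \<exists>g\<in>E. \<forall>w\<in>W. \<bar>f w - g w\<bar> \<le> inverse (real (Suc n))"
    using f unfolding uniform_closure_def by (auto simp del: of_nat_Suc)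
  then obtain g where g: "\<And>n. g n \<in> E" "\<And>n w. w \<in> W \<Longrightarrow> \<bar>f w - g n w\<bar> \<le> inverse (real (Suc n))"
    by metis
  have "uniform_limit W g f sequentially"
  proof (rule uniform_limitI)
    fix e :: real assume e: "e > 0"
    then obtain N where N: "inverse (real (Suc N)) < e"
      using reals_Archimedean by blast
    show "\<forall>\<^sub>F n in sequentially. \<forall>w\<in>W. dist (g n w) (f w) < e"
      unfolding eventually_sequentially
    proof (intro exI allI impI ballI)
      fix n w assume n: "n \<ge> N" and w: "w \<in> W"
      have "dist (g n w) (f w) \<le> inverse (real (Suc n))"
        using g(2)[OF w, of n] by (simp add: dist_real_def abs_minus_commute)
      also have "\<dots> \<le> inverse (real (Suc N))" using n by (intro le_imp_inverse_le) auto
      finally show "dist (g n w) (f w) < e" using N by simp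
    qed
  qed
  moreover have "\<forall>\<^sub>F n in sequentially. continuous_on W (g n)"
    using g(1) assms by (intro always_eventually) (auto simp: contf_def)
  ultimately show "f \<in> contf W"
    unfolding contf_def by (simp add: uniform_limit_theorem)
qed

lemma uniform_closure_series:
  assumes E: "subspace E" and g: "\<And>j. g j \<in> uniform_closure W E"
    and C: "\<And>j w. w \<in> W \<Longrightarrow> \<bar>g j w\<bar> \<le> C"
  shows "(\<lambda>w. \<Sum>j. (1/2)^Suc j * g j w) \<in> uniform_closure W E"
proof (cases "W = {}")
  case True
  have "E \<noteq> {}" using subspace_0[OF E] by blast
  then show ?thesis unfolding True uniform_closure_def by simp
next
  case False
  define f where "f w = (\<Sum>j. (1/2)^Suc j * g j w)" for w
  have pw: "(\<lambda>j. (1/2)^Suc j * C) sums C" using sums_mult2[OF power_half_series, of C] by simp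
  have "f \<in> uniform_closure W E"
  proof (rule uniform_closure_idem)
    fix e :: real assume e: "e > 0"
    have "uniform_limit W (\<lambda>n w. \<Sum>j<n. (1/2)^Suc j * g j w) f sequentially"
      unfolding f_def
    proof (rule Weierstrass_m_test)
      show "summable (\<lambda>j. (1/2)^Suc j * C)" using pw by (rule sums_summable)
      show "norm ((1/2)^Suc j * g j w) \<le> (1/2)^Suc j * C" if "w \<in> W" for j w
        using C[OF that, of j] by (simp add: abs_mult)
    qed
    then obtain n where n: "\<forall>w\<in>W. dist (\<Sum>j<n. (1/2)^Suc j * g j w) (f w) < e"
      using e unfolding uniform_limit_iff eventually_sequentially by blast
    have "(\<Sum>j<n. (1/2)^Suc j *\<^sub>R g j) \<in> uniform_closure W E"
      using g subspace_uniform_closure[OF E] by (intro subspace_sum subspace_scale)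
    moreover have "(\<Sum>j<n. (1/2)^Suc j *\<^sub>R g j) w = (\<Sum>j<n. (1/2)^Suc j * g j w)" for w
      by (induction n) simp_all
    then have "\<forall>w\<in>W. \<bar>f w - (\<Sum>j<n. (1/2)^Suc j *\<^sub>R g j) w\<bar> \<le> e"
      using n by (simp add: dist_real_def abs_minus_commute less_imp_le)
    ultimately show "\<exists>g\<in>uniform_closure W E. \<forall>w\<in>W. \<bar>f w - g w\<bar> \<le> e" by blast
  qed
  then show ?thesis by (simp add: f_def[abs_def])
qed

section \<open>Minorants of the supremum on a compact set\<close>

context
  fixes W :: "'w::t2_space set"
  assumes compact_W: "compact W" and W_ne: "W \<noteq> {}"
begin

lemma contf_bounded:
  assumes "f \<in> contf W"
  obtains K where "K > 0" "\<And>w. w \<in> W \<Longrightarrow> \<bar>f w\<bar> \<le> K"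
proof -
  have "bounded (f ` W)"
    using assms compact_W unfolding contf_def
    by (intro compact_imp_bounded compact_continuous_image) auto
  then show thesis using that by (auto simp: bounded_pos)
qed

lemma le_supw:
  assumes "f \<in> contf W" "w \<in> W"
  shows "f w \<le> supw W f"
proof -
  obtain K where "\<And>w. w \<in> W \<Longrightarrow> \<bar>f w\<bar> \<le> K" using contf_bounded[OF assms(1)] by blast
  then have "bdd_above (f ` W)" by (intro bdd_aboveI2[of _ _ K]) (auto simp: abs_le_iff)
  then show ?thesis unfolding supw_def using assms(2) by (rule cSUP_upper2) simp
qed

lemma supw_least: "(\<And>w. w \<in> W \<Longrightarrow> f w \<le> c) \<Longrightarrow> supw W f \<le> c"
  unfolding supw_def using W_ne by (rule cSUP_least)

lemma supw_cong: "(\<And>w. w \<in> W \<Longrightarrow> f w = g w) \<Longrightarrow> supw W f = supw W g"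
  unfolding supw_def by (rule SUP_cong) auto

lemma sublinear_on_supw: "sublinear_on (contf W) (supw W)"
  unfolding sublinear_on_def
proof (intro conjI ballI allI impI)
  fix f g assume fg: "f \<in> contf W" "g \<in> contf W"
  show "supw W (f + g) \<le> supw W f + supw W g"
    using le_supw[OF fg(1)] le_supw[OF fg(2)] by (intro supw_least) (simp add: add_mono)
next
  fix f and c :: real assume f: "f \<in> contf W" and c: "0 < c"
  have cf: "c *\<^sub>R f \<in> contf W" using f by (rule subspace_scale[OF subspace_contf])
  have "supw W (c *\<^sub>R f) \<le> c * supw W f"
    using le_supw[OF f] c by (intro supw_least) simp
  moreover have "supw W f \<le> inverse c * supw W (c *\<^sub>R f)"
  proof (rule supw_least)
    fix w assume "w \<in> W"
    from le_supw[OF cf this] show "f w \<le> inverse c * supw W (c *\<^sub>R f)"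
      using c by (simp add: field_simps)
  qed
  ultimately show "supw W (c *\<^sub>R f) = c * supw W f"
    using c by (simp add: field_simps)
qed

lemma eval_minorant:
  assumes "E \<subseteq> contf W" "w \<in> W"
  shows "minorant E (supw W) (\<lambda>f. f w)"
  using assms le_supw unfolding minorant_def functional_on_def by auto

text \<open>Positivity and normalisation of the measure in a single estimate, obtained from
  \<open>\<mu> \<le> supw W\<close> at \<open>f - g\<close>; the constant \<open>c\<close> need not
  belong to \<open>E\<close>.\<close>

lemma mono_minorant:
  assumes \<mu>: "minorant E (supw W) \<mu>" and E: "subspace E" "f \<in> E" "g \<in> E"
    and le: "\<And>w. w \<in> W \<Longrightarrow> f w \<le> g w + c"
  shows "\<mu> f \<le> \<mu> g + c"
proof -
  have "\<mu> (f - g) \<le> supw W (f - g)"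
    using \<mu> E by (auto simp: minorant_def subspace_diff)
  also have "\<dots> \<le> c" using le by (intro supw_least) (simp add: algebra_simps)
  finally show ?thesis
    using functional_on_diff[of E \<mu> f g] \<mu> E by (simp add: minorant_def)
qed

lemma minorant_const:
  assumes \<mu>: "minorant (contf W) (supw W) \<mu>"
  shows "\<mu> (\<lambda>_. c) = c"
proof -
  have c: "(\<lambda>_. c) \<in> contf W" for c by (simp add: contf_def)
  have 0: "\<mu> (\<lambda>_. 0) = 0"
    using functional_on_zero[of "contf W" \<mu>] \<mu> subspace_contf[of W]
    by (simp add: minorant_def zero_fun_def)
  have "\<mu> (\<lambda>_. c) \<le> \<mu> (\<lambda>_. 0) + c"
    by (rule mono_minorant[OF \<mu> subspace_contf c c]) simp
  moreover have "\<mu> (\<lambda>_. 0) \<le> \<mu> (\<lambda>_. c) + (- c)"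
    by (rule mono_minorant[OF \<mu> subspace_contf c c]) simp
  ultimately show ?thesis using 0 by simp
qed

lemma minorant_lincomb:
  assumes \<mu>: "minorant (contf W) (supw W) \<mu>" and "f \<in> contf W" "g \<in> contf W"
  shows "\<mu> (\<lambda>w. a * f w + b * g w) = a * \<mu> f + b * \<mu> g"
proof -
  have "\<mu> (a *\<^sub>R f + b *\<^sub>R g) = \<mu> (a *\<^sub>R f) + \<mu> (b *\<^sub>R g)"
    using assms subspace_scale[OF subspace_contf[of W]]
    unfolding minorant_def functional_on_def by blast
  also have "\<dots> = a * \<mu> f + b * \<mu> g"
    using assms unfolding minorant_def functional_on_def by simp
  also have "a *\<^sub>R f + b *\<^sub>R g = (\<lambda>w. a * f w + b * g w)"
    by (simp add: fun_eq_iff)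
  finally show ?thesis .
qed

text \<open>The weights \<open>1 + s (g - q g)/(2K)\<close>, \<open>s = 1, -1\<close>, split \<open>\<mu>\<close> into two minorants with mean \<open>\<mu>\<close>; by
  extremality they agree on \<open>g\<close>, which says that the variance of \<open>g\<close> vanishes.\<close>
lemma extreme_minorant_variance:
  assumes E: "E \<subseteq> contf W" and q: "extreme_minorant E (supw W) q"
    and \<mu>: "minorant (contf W) (supw W) \<mu>" and ext: "\<And>e. e \<in> E \<Longrightarrow> \<mu> e = q e" and g: "g \<in> E"
  shows "\<mu> (\<lambda>w. (g w - q g)\<^sup>2) = 0"
proof -
  define d where "d w = g w - q g" for w
  have gC: "g \<in> contf W" using g E by auto
  have dC: "d \<in> contf W" using gC unfolding d_def contf_def by (auto intro!: continuous_intros)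
  have oneC: "(\<lambda>_. 1) \<in> contf W" by (simp add: contf_def)
  have \<mu>d: "\<mu> d = 0"
    using minorant_lincomb[OF \<mu> gC oneC, of 1 "- q g"] minorant_const[OF \<mu>, of 1] ext[OF g]
    by (simp add: d_def[abs_def])
  obtain K where K: "K > 0" "\<And>w. w \<in> W \<Longrightarrow> \<bar>d w\<bar> \<le> K" using contf_bounded[OF dC] by blast
  define wt where "wt s w = 1 + s * d w / (2 * K)" for s w
  have half: "minorant E (supw W) (\<lambda>f. \<mu> (\<lambda>w. wt s w * f w))" if s: "\<bar>s\<bar> \<le> 1" for s
  proof -
    have wtC: "wt s \<in> contf W"
      using dC K(1) unfolding wt_def contf_def by (auto intro!: continuous_intros)
    have wtfC: "(\<lambda>w. wt s w * f w) \<in> contf W" if "f \<in> contf W" for f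
      using wtC that unfolding contf_def by (auto intro!: continuous_intros)
    have \<mu>wt: "\<mu> (wt s) = 1"
      using minorant_lincomb[OF \<mu> oneC dC, of 1 "s / (2 * K)"] minorant_const[OF \<mu>, of 1] \<mu>d
      by (simp add: wt_def[abs_def])
    have pos: "wt s w \<ge> 0" if "w \<in> W" for w
    proof -
      have "\<bar>s * d w\<bar> \<le> 1 * K"
        unfolding abs_mult using s K(2)[OF that] by (intro mult_mono) auto
      then show ?thesis using K(1) unfolding wt_def by (simp add: field_simps abs_le_iff)
    qed
    show ?thesis
      unfolding minorant_def functional_on_def
    proof (intro conjI ballI allI)
      fix u v assume uv: "u \<in> E" "v \<in> E"
      have "(\<lambda>w. wt s w * (u + v) w) = (\<lambda>w. 1 * (wt s w * u w) + 1 * (wt s w * v w))"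
        by (simp add: algebra_simps)
      then show "\<mu> (\<lambda>w. wt s w * (u + v) w) = \<mu> (\<lambda>w. wt s w * u w) + \<mu> (\<lambda>w. wt s w * v w)"
        using minorant_lincomb[OF \<mu> wtfC wtfC, of u v 1 1] uv E by auto
    next
      fix u and c :: real assume u: "u \<in> E"
      have "(\<lambda>w. wt s w * (c *\<^sub>R u) w) = (\<lambda>w. c * (wt s w * u w) + 0 * (wt s w * u w))"
        by (simp add: algebra_simps)
      then show "\<mu> (\<lambda>w. wt s w * (c *\<^sub>R u) w) = c * \<mu> (\<lambda>w. wt s w * u w)"
        using minorant_lincomb[OF \<mu> wtfC wtfC, of u u c 0] u E by auto
    next
      fix u assume u: "u \<in> E"
      then have uC: "u \<in> contf W" using E by auto
      \<comment> \<open>The weight is nonnegative and has mean 1 because \<open>\<mu> d = 0\<close>.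
        The zero term gives the bound the shape that \<open>minorant_lincomb\<close>
        evaluates.\<close>
      have "\<mu> (\<lambda>w. wt s w * u w) \<le> \<mu> (\<lambda>w. supw W u * wt s w + 0 * wt s w) + 0"
      proof (rule mono_minorant[OF \<mu> subspace_contf wtfC[OF uC]])
        show "(\<lambda>w. supw W u * wt s w + 0 * wt s w) \<in> contf W"
          using wtC unfolding contf_def by (auto intro!: continuous_intros)
        show "wt s w * u w \<le> supw W u * wt s w + 0 * wt s w + 0" if w: "w \<in> W" for w
          using mult_left_mono[OF le_supw[OF uC w] pos[OF w]] by (simp add: mult.commute)
      qed
      then show "\<mu> (\<lambda>w. wt s w * u w) \<le> supw W u"
        using minorant_lincomb[OF \<mu> wtC wtC, of "supw W u" 0] \<mu>wt by simp
    qed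
  qed
  have mean: "q f = 1/2 * \<mu> (\<lambda>w. wt 1 w * f w) + (1 - 1/2) * \<mu> (\<lambda>w. wt (-1) w * f w)" if f: "f \<in> E" for f
  proof -
    have fC: "(\<lambda>w. wt s w * f w) \<in> contf W" for s
      using f E dC K(1) unfolding wt_def contf_def by (auto intro!: continuous_intros)
    have "f = (\<lambda>w. 1/2 * (wt 1 w * f w) + (1 - 1/2) * (wt (-1) w * f w))"
      using K(1) by (simp add: wt_def fun_eq_iff field_simps)
    then have "\<mu> f = \<mu> (\<lambda>w. 1/2 * (wt 1 w * f w) + (1 - 1/2) * (wt (-1) w * f w))" by simp
    then show ?thesis
      using minorant_lincomb[OF \<mu> fC fC, of "1/2" 1 "1 - 1/2" "-1"] ext[OF f] by simp
  qed
  have "\<forall>f\<in>E. \<mu> (\<lambda>w. wt 1 w * f w) = \<mu> (\<lambda>w. wt (-1) w * f w)"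
    by (rule extreme_minorantD[OF q, of _ _ "1/2"]) (use half[of 1] half[of "-1"] mean in simp_all)
  then have eq: "\<mu> (\<lambda>w. wt 1 w * g w) = \<mu> (\<lambda>w. wt (-1) w * g w)" using g by blast
  have wtgC: "(\<lambda>w. wt s w * g w) \<in> contf W" for s
    using gC dC K(1) unfolding wt_def contf_def by (auto intro!: continuous_intros)
  have dgC: "(\<lambda>w. d w * g w) \<in> contf W"
    using gC dC unfolding contf_def by (auto intro!: continuous_intros)
  \<comment> \<open>Since \<open>wt 1 - wt (-1) = d / K\<close>, the agreement on \<open>g\<close>
    says that \<open>d * g\<close> has mean 0; as \<open>\<mu> d = 0\<close>, that mean is the
    variance of \<open>g\<close>.\<close>
  have "(\<lambda>w. d w * g w) = (\<lambda>w. K * (wt 1 w * g w) + (- K) * (wt (-1) w * g w))"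
    using K(1) by (simp add: wt_def fun_eq_iff field_simps)
  then have "\<mu> (\<lambda>w. d w * g w) = 0"
    using minorant_lincomb[OF \<mu> wtgC wtgC, of K 1 "- K" "-1"] eq by simp
  moreover have "(\<lambda>w. (g w - q g)\<^sup>2) = (\<lambda>w. 1 * (d w * g w) + (- q g) * d w)"
    by (simp add: d_def fun_eq_iff power2_eq_square algebra_simps)
  ultimately show ?thesis
    using minorant_lincomb[OF \<mu> dgC dC, of 1 "- q g"] \<mu>d by simp
qed

text \<open>With all variances zero, the measure \<open>\<mu>\<close> is carried by the points where
  every \<open>g\<close> in \<open>E\<close> takes the value \<open>q g\<close>. Compactness reduces
  this to finitely many \<open>g\<close> on the set where \<open>f\<close> is far from
  \<open>c\<close>; there the sum of the squares has a positive lower bound, so a multiple of it, of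
  mean 0, dominates the deviation. If there is no such point, \<open>c\<close> is arbitrary.\<close>

lemma extreme_minorant_concentrated:
  assumes E: "E \<subseteq> contf W" and q: "extreme_minorant E (supw W) q"
    and \<mu>: "minorant (contf W) (supw W) \<mu>" and ext: "\<And>e. e \<in> E \<Longrightarrow> \<mu> e = q e"
    and f: "f \<in> contf W" and c: "\<And>w. w \<in> W \<Longrightarrow> (\<And>g. g \<in> E \<Longrightarrow> g w = q g) \<Longrightarrow> f w = c"
  shows "\<mu> f = c"
proof -
  have bound: "\<bar>\<mu> f - c\<bar> \<le> e" if e: "e > 0" for e
  proof -
    define K where "K = W \<inter> (\<lambda>w. \<bar>f w - c\<bar>) -` {e..}"
    define Z where "Z g = W \<inter> g -` {q g}" for g
    have fc: "continuous_on W f" using f by (simp add: contf_def)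
    have clW: "closed W" using compact_W by (rule compact_imp_closed)
    have "closed K" unfolding K_def
      using fc clW by (intro continuous_closed_preimage continuous_intros) auto
    moreover have "W \<inter> K = K" unfolding K_def by blast
    ultimately have cK: "compact K"
      using compact_Int_closed[OF compact_W, of K] by simp
    have clZ: "closed (Z g)" if "g \<in> E" for g
      unfolding Z_def using that E clW
      by (intro continuous_closed_preimage) (auto simp: contf_def)
    have "\<exists>I. finite I \<and> I \<subseteq> E \<and> K \<inter> (\<Inter>g\<in>I. Z g) = {}"
    proof (rule ccontr)
      assume "\<not> ?thesis"
      then have fin: "\<And>I. finite I \<Longrightarrow> I \<subseteq> E \<Longrightarrow> K \<inter> (\<Inter>g\<in>I. Z g) \<noteq> {}" by blast
      have "K \<inter> (\<Inter>g\<in>E. Z g) \<noteq> {}"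
        by (rule compact_imp_fip_image[OF cK clZ fin])
      then obtain w where w: "w \<in> K" "\<And>g. g \<in> E \<Longrightarrow> w \<in> Z g" by blast
      then have "w \<in> W" "\<And>g. g \<in> E \<Longrightarrow> g w = q g" by (simp_all add: Z_def K_def)
      then have "f w = c" by (rule c)
      then show False using w(1) e by (simp add: K_def)
    qed
    then obtain I where I: "finite I" "I \<subseteq> E" "K \<inter> (\<Inter>g\<in>I. Z g) = {}" by blast
    define s where "s = (\<Sum>g\<in>I. (\<lambda>w. (g w - q g)\<^sup>2))"
    have s_apply: "s w = (\<Sum>g\<in>I. (g w - q g)\<^sup>2)" for w
      unfolding s_def using I(1) by (induction I rule: finite_induct) simp_all
    have sqC: "(\<lambda>w. (g w - q g)\<^sup>2) \<in> contf W" if "g \<in> I" for g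
      using that I(2) E by (auto simp: contf_def intro!: continuous_intros)
    have sC: "s \<in> contf W"
      unfolding s_def using sqC by (rule subspace_sum[OF subspace_contf])
    have "\<mu> s = (\<Sum>g\<in>I. \<mu> (\<lambda>w. (g w - q g)\<^sup>2))"
      unfolding s_def using \<mu> sqC I(1)
      by (intro functional_on_sum[OF _ subspace_contf]) (auto simp: minorant_def)
    also have "\<dots> = 0"
      using extreme_minorant_variance[OF E q \<mu> ext] I(2) by (intro sum.neutral) auto
    finally have \<mu>s: "\<mu> s = 0" .
    have snn: "s w \<ge> 0" for w unfolding s_apply by (intro sum_nonneg) auto
    have spos: "s w > 0" if w: "w \<in> K" for w
    proof -
      obtain g where g: "g \<in> I" "w \<notin> Z g" using w I(3) by blast
      have "g w \<noteq> q g" using g(2) w by (auto simp: Z_def K_def)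
      then have "0 < (g w - q g)\<^sup>2" by simp
      also have "\<dots> \<le> s w" unfolding s_apply
        using g(1) I(1) by (intro member_le_sum) auto
      finally show ?thesis .
    qed
    have "\<exists>\<delta>>0. \<forall>w\<in>K. \<delta> \<le> s w"
    proof (cases "K = {}")
      case True
      have "(1::real) > 0" by simp
      then show ?thesis using True by blast
    next
      case False
      have "continuous_on K s" using sC unfolding contf_def K_def
        by (auto intro: continuous_on_subset)
      then obtain w0 where "w0 \<in> K" "\<forall>w\<in>K. s w0 \<le> s w"
        using continuous_attains_inf[OF cK False] by blast
      then show ?thesis using spos by blast
    qed
    then obtain \<delta> where \<delta>: "\<delta> > 0" "\<And>w. w \<in> K \<Longrightarrow> \<delta> \<le> s w" by blast
    have fcC: "(\<lambda>w. f w - c) \<in> contf W" using fc by (auto simp: contf_def intro!: continuous_intros)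
    obtain B where B: "B > 0" "\<And>w. w \<in> W \<Longrightarrow> \<bar>f w - c\<bar> \<le> B" using contf_bounded[OF fcC] by blast
    \<comment> \<open>On \<open>K\<close> the multiple \<open>B / \<delta>\<close> of
      \<open>s\<close> already exceeds the bound \<open>B\<close>; off \<open>K\<close> the
      deviation is below \<open>e\<close>.\<close>
    have dom: "\<bar>f w - c\<bar> \<le> e + B / \<delta> * s w" if w: "w \<in> W" for w
    proof (cases "w \<in> K")
      case True
      have "B \<le> B / \<delta> * s w"
        using mult_left_mono[OF \<delta>(2)[OF True], of "B / \<delta>"] B(1) \<delta>(1) by simp
      then show ?thesis using B(2)[OF w] e by linarith
    next
      case False
      then have "\<bar>f w - c\<bar> < e" using w by (auto simp: K_def)
      moreover have "0 \<le> B / \<delta> * s w" using snn B(1) \<delta>(1) by simp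
      ultimately show ?thesis by linarith
    qed
    define r where "r = B / \<delta>"
    have scC: "a *\<^sub>R s \<in> contf W" for a
      using sC by (rule subspace_scale[OF subspace_contf])
    have \<mu>sc: "\<mu> (a *\<^sub>R s) = 0" for a
      using \<mu> sC \<mu>s by (simp add: minorant_def functional_on_def)
    have "\<mu> f \<le> \<mu> (r *\<^sub>R s) + (c + e)"
    proof (rule mono_minorant[OF \<mu> subspace_contf f scC])
      fix w assume "w \<in> W"
      from dom[OF this] show "f w \<le> (r *\<^sub>R s) w + (c + e)"
        unfolding r_def[symmetric] scaleR_fun_apply real_scaleR_def by linarith
    qed
    moreover have "\<mu> ((- r) *\<^sub>R s) \<le> \<mu> f + (e - c)"
    proof (rule mono_minorant[OF \<mu> subspace_contf scC f])
      fix w assume "w \<in> W"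
      from dom[OF this] show "((- r) *\<^sub>R s) w \<le> f w + (e - c)"
        unfolding r_def[symmetric] scaleR_fun_apply real_scaleR_def mult_minus_left by linarith
    qed
    ultimately show ?thesis unfolding \<mu>sc by linarith
  qed
  have "\<bar>\<mu> f - c\<bar> \<le> 0"
    by (rule field_le_epsilon) (unfold add_0, rule bound)
  then show ?thesis by simp
qed

text \<open>If no point represented \<open>q\<close>, the concentration lemma would apply vacuously
  with any \<open>c\<close>; the zero function with \<open>c = 1\<close> gives a
  contradiction.\<close>

lemma extreme_minorant_eval:
  assumes E: "subspace E" "E \<subseteq> contf W" and q: "extreme_minorant E (supw W) q"
  obtains w where "w \<in> W" "\<And>g. g \<in> E \<Longrightarrow> g w = q g"
proof (rule ccontr)
  assume no: "\<not> thesis"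
  have z: "(\<lambda>_. 0) \<in> contf W" by (simp add: contf_def)
  have qm: "minorant E (supw W) q" using q by (simp add: extreme_minorant_def)
  obtain \<mu> where \<mu>: "minorant (contf W) (supw W) \<mu>" "\<And>e. e \<in> E \<Longrightarrow> \<mu> e = q e"
    using hahn_banach_minorant[OF subspace_contf sublinear_on_supw E qm z] by metis
  have "\<mu> (\<lambda>_. 0) = 1"
    using no that by (intro extreme_minorant_concentrated[OF E(2) q \<mu> z]) blast+
  then show False using minorant_const[OF \<mu>(1), of 0] by simp
qed

text \<open>Separation leaves \<open>x\<close> as the only point representing \<open>q\<close>, so
  every extension of \<open>q\<close> is evaluation at \<open>x\<close>, including the one with the
  largest value at \<open>f\<close>. Hence the infimum of \<open>supw W (f + e) - q e\<close> over
  \<open>E\<close> is \<open>f x\<close>, and an almost minimizing \<open>u\<close> gives the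
  majorant \<open>supw W (f + u) - u\<close>, which is in \<open>E\<close> thanks to the
  constants.\<close>

lemma extreme_minorant_sandwich:
  assumes E: "subspace E" "E \<subseteq> contf W" and q: "extreme_minorant E (supw W) q"
    and one: "(\<lambda>_. 1) \<in> E" and x: "x \<in> W" "\<And>g. g \<in> E \<Longrightarrow> g x = q g"
    and sep: "\<And>w. w \<in> W \<Longrightarrow> w \<noteq> x \<Longrightarrow> \<exists>g\<in>E. g w \<noteq> g x"
    and f: "f \<in> contf W" and e: "\<epsilon> > 0"
  obtains g where "g \<in> E" "\<And>w. w \<in> W \<Longrightarrow> f w \<le> g w" "g x < f x + \<epsilon>"
proof -
  have qm: "minorant E (supw W) q" using q by (simp add: extreme_minorant_def)
  obtain \<mu> where \<mu>: "minorant (contf W) (supw W) \<mu>" "\<And>e. e \<in> E \<Longrightarrow> \<mu> e = q e"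
    "\<mu> f = lowered E q (supw W) f"
    using hahn_banach_minorant[OF subspace_contf sublinear_on_supw E qm f] by metis
  have "\<mu> f = f x"
    using sep x(2) by (intro extreme_minorant_concentrated[OF E(2) q \<mu>(1,2) f]) metis+
  then have "(INF e\<in>E. supw W (f + e) - q e) < f x + \<epsilon>"
    using \<mu>(3) e by (simp add: lowered_def)
  then obtain u where u: "u \<in> E" "supw W (f + u) - q u < f x + \<epsilon>"
    using subspace_0[OF E(1)] by (metis (no_types, lifting) cInf_lessD empty_iff image_iff image_is_empty)
  define s where "s = supw W (f + u)"
  define g where "g = s *\<^sub>R (\<lambda>_. 1) - u"
  have "g \<in> E" unfolding g_def using u one E(1) by (intro subspace_diff subspace_scale)
  moreover have "f w \<le> g w" if "w \<in> W" for w
  proof -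
    have "f + u \<in> contf W" using f u E(2) by (intro subspace_add[OF subspace_contf]) auto
    from le_supw[OF this that] show ?thesis by (simp add: g_def s_def)
  qed
  moreover have "g x < f x + \<epsilon>" using u x(2)[OF u(1)] by (simp add: g_def s_def)
  ultimately show thesis using that by blast
qed

text \<open>An extreme minorant that touches the supremum at \<open>f\<close> is an evaluation: a
  form of Bauer's maximum principle.\<close>

lemma sup_attained_at_extreme_pt:
  assumes E: "subspace E" "E \<subseteq> contf W" and f: "f \<in> E"
  obtains w where "extreme_pt W E w" "f w = supw W f"
proof -
  have sub: "sublinear_on E (supw W)"
    using sublinear_on_supw E(2) unfolding sublinear_on_def by (meson subsetD)
  obtain q where q: "extreme_minorant E (supw W) q" "q f = supw W f"
    using exists_extreme_minorant[OF E(1) sub f] by blast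
  obtain w where w: "w \<in> W" "\<And>g. g \<in> E \<Longrightarrow> g w = q g"
    using extreme_minorant_eval[OF E q(1)] by blast
  have "extreme_minorant E (supw W) (\<lambda>f. f w)"
    using q(1) w(2) eval_minorant[OF E(2) w(1)] unfolding extreme_minorant_def by (metis (mono_tags, lifting))
  then show thesis using that[of w] w q(2) f by (simp add: extreme_pt_def)
qed

text \<open>Minorants on \<open>E\<close> extend to the closure by Hahn-Banach and are 1-Lipschitz
  for the uniform distance there, so a convex decomposition of the evaluation on \<open>E\<close>
  persists on the closure.\<close>

lemma extreme_pt_uniform_closure:
  assumes E: "subspace E" "E \<subseteq> contf W" and w: "extreme_pt W (uniform_closure W E) w"
  shows "extreme_pt W E w"
proof -
  define V where "V = uniform_closure W E"
  have V: "subspace V" "V \<subseteq> contf W" "E \<subseteq> V"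
    unfolding V_def
    by (rule subspace_uniform_closure[OF E(1)] uniform_closure_contf[OF E(2)]
      subset_uniform_closure)+
  have sub: "sublinear_on V (supw W)"
    using sublinear_on_supw V(2) unfolding sublinear_on_def by (meson subsetD)
  have wW: "w \<in> W" using w by (simp add: extreme_pt_def)
  have extend: "\<exists>a'. minorant V (supw W) a' \<and> (\<forall>e\<in>E. a' e = a e)" if "minorant E (supw W) a" for a
    using hahn_banach_minorant[OF V(1) sub E(1) V(3) that subspace_0[OF V(1)]] by metis
  have close: "\<bar>a f - a g\<bar> \<le> e"
    if a: "minorant V (supw W) a" and fg: "f \<in> V" "g \<in> V" "\<And>w. w \<in> W \<Longrightarrow> \<bar>f w - g w\<bar> \<le> e" for a f g e
  proof -
    have "a f \<le> a g + e" using a fg by (intro mono_minorant[OF a V(1)]) (auto simp: abs_le_iff algebra_simps)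
    moreover have "a g \<le> a f + e"
    proof (rule mono_minorant[OF a V(1) fg(2,1)])
      fix w assume "w \<in> W"
      from fg(3)[OF this] show "g w \<le> f w + e" by linarith
    qed
    ultimately show ?thesis by linarith
  qed
  have "extreme_minorant E (supw W) (\<lambda>f. f w)"
    unfolding extreme_minorant_def
  proof (intro conjI allI impI)
    show "minorant E (supw W) (\<lambda>f. f w)" by (rule eval_minorant[OF E(2) wW])
    fix a b t
    assume H: "minorant E (supw W) a \<and> minorant E (supw W) b \<and> 0 < t \<and> t < 1 \<and>
       (\<forall>u\<in>E. u w = t * a u + (1 - t) * b u)"
    then have t: "0 < t" "t < 1"
      and eqE: "\<And>u. u \<in> E \<Longrightarrow> t * a u + (1 - t) * b u = u w" by simp_all
    obtain a' where a': "minorant V (supw W) a'" "\<And>e. e \<in> E \<Longrightarrow> a' e = a e" using extend H by blast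
    obtain b' where b': "minorant V (supw W) b'" "\<And>e. e \<in> E \<Longrightarrow> b' e = b e" using extend H by blast
    have eqV: "f w = t * a' f + (1 - t) * b' f" if f: "f \<in> V" for f
    proof -
      have bound: "\<bar>f w - (t * a' f + (1 - t) * b' f)\<bar> \<le> e" if e: "e > 0" for e
      proof -
        obtain g where g: "g \<in> E" "\<And>w. w \<in> W \<Longrightarrow> \<bar>f w - g w\<bar> \<le> e/2"
          using f e unfolding V_def uniform_closure_def by (auto dest!: spec[of _ "e/2"])
        have gV: "g \<in> V" using g V by auto
        have "\<bar>t * (a' f - a' g)\<bar> \<le> t * (e/2)" "\<bar>(1 - t) * (b' f - b' g)\<bar> \<le> (1 - t) * (e/2)"
          unfolding abs_mult
          using mult_mono[OF order.refl close[OF a'(1) f gV g(2)], of "\<bar>t\<bar>"]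
            mult_mono[OF order.refl close[OF b'(1) f gV g(2)], of "\<bar>1 - t\<bar>"] t
          by simp_all
        then have "\<bar>t * (a' f - a' g) + (1 - t) * (b' f - b' g)\<bar> \<le> t * (e/2) + (1 - t) * (e/2)"
          by linarith
        also have "t * (e/2) + (1 - t) * (e/2) = e/2" by (simp add: field_simps)
        also have "t * (a' f - a' g) + (1 - t) * (b' f - b' g)
            = (t * a' f + (1 - t) * b' f) - (t * a' g + (1 - t) * b' g)"
          by (simp add: algebra_simps)
        also have "t * a' g + (1 - t) * b' g = g w"
          unfolding a'(2)[OF g(1)] b'(2)[OF g(1)] by (rule eqE[OF g(1)])
        finally show ?thesis using g(2)[OF wW] by linarith
      qed
      have "\<bar>f w - (t * a' f + (1 - t) * b' f)\<bar> \<le> 0"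
        by (rule field_le_epsilon) (unfold add_0, rule bound)
      then show ?thesis by simp
    qed
    have "extreme_minorant V (supw W) (\<lambda>f. f w)"
      using w by (simp add: extreme_pt_def V_def)
    from extreme_minorantD[OF this a'(1) b'(1) t eqV]
    have eq: "\<forall>u\<in>V. a' u = b' u" .
    show "\<forall>u\<in>E. a u = b u"
    proof
      fix u assume u: "u \<in> E"
      then have "a' u = b' u" using eq V(3) by blast
      then show "a u = b u" using a'(2)[OF u] b'(2)[OF u] by simp
    qed
  qed
  then show ?thesis using wW by (simp add: extreme_pt_def)
qed

end

section \<open>Pointwise convergence from convergence at extreme points\<close>

text \<open>A pointwise substitute for membership in the \<open>\<sigma>\<close>-convex hull of \<open>F n, F (n + 1), \<dots>\<close>.\<close>
definition between_tails :: "'w set \<Rightarrow> (nat \<Rightarrow> 'w \<Rightarrow> real) \<Rightarrow> nat \<Rightarrow> ('w \<Rightarrow> real) \<Rightarrow> bool" where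
  "between_tails W F n g \<longleftrightarrow> (\<forall>w\<in>W. \<forall>c. ((\<forall>k\<ge>n. F k w \<le> c) \<longrightarrow> g w \<le> c) \<and>
     ((\<forall>k\<ge>n. c \<le> F k w) \<longrightarrow> c \<le> g w))"

lemma between_tails_self: "between_tails W F n (F n)"
  by (simp add: between_tails_def)

lemma between_tails_mono: "between_tails W F n g \<Longrightarrow> m \<le> n \<Longrightarrow> between_tails W F m g"
  by (simp add: between_tails_def)

lemma between_tails_upper:
  "between_tails W F n g \<Longrightarrow> w \<in> W \<Longrightarrow> (\<And>k. k \<ge> n \<Longrightarrow> F k w \<le> c) \<Longrightarrow> g w \<le> c"
  by (simp add: between_tails_def)

lemma between_tails_lower:
  "between_tails W F n g \<Longrightarrow> w \<in> W \<Longrightarrow> (\<And>k. k \<ge> n \<Longrightarrow> c \<le> F k w) \<Longrightarrow> c \<le> g w"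
  by (simp add: between_tails_def)

text \<open>The weights sum to 1, which preserves bounds, and the geometric sequence reproduces
  itself under a shift, which gives the recursion \<open>T n = (g n + T (Suc n)) / 2\<close> in
  Simons' argument.\<close>

lemma
  fixes a :: "nat \<Rightarrow> real"
  assumes "\<And>j. \<bar>a j\<bar> \<le> C"
  shows half_series_le: "(\<And>j. a j \<le> c) \<Longrightarrow> (\<Sum>j. (1/2)^Suc j * a j) \<le> c"
    and half_series_ge: "(\<And>j. c \<le> a j) \<Longrightarrow> c \<le> (\<Sum>j. (1/2)^Suc j * a j)"
    and half_series_split: "(\<Sum>j. (1/2)^Suc j * a j) = a 0 / 2 + (\<Sum>j. (1/2)^Suc j * a (Suc j)) / 2"
proof -
  have pw: "(\<lambda>j. (1/2)^Suc j * c) sums c" for c :: real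
    using sums_mult2[OF power_half_series, of c] by simp
  have summable: "summable (\<lambda>j. (1/2)^Suc j * b j)" if "\<And>j. \<bar>b j\<bar> \<le> C" for b :: "nat \<Rightarrow> real"
  proof (rule summable_comparison_test')
    show "summable (\<lambda>j. (1/2)^Suc j * C)" using pw by (rule sums_summable)
    show "norm ((1/2)^Suc j * b j) \<le> (1/2)^Suc j * C" for j
      using that[of j] by (simp add: abs_mult)
  qed
  have sm: "summable (\<lambda>j. (1/2)^Suc j * a j)" by (rule summable) (rule assms)
  show "(\<Sum>j. (1/2)^Suc j * a j) \<le> c" if "\<And>j. a j \<le> c"
    using that by (intro sums_le[OF _ summable_sums[OF sm] pw]) simp
  show "c \<le> (\<Sum>j. (1/2)^Suc j * a j)" if "\<And>j. c \<le> a j"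
    using that by (intro sums_le[OF _ pw summable_sums[OF sm]]) simp
  have "(\<Sum>j. (1/2)^Suc j * a j) = (1/2)^Suc 0 * a 0 + (\<Sum>j. (1/2)^Suc (Suc j) * a (Suc j))"
    using suminf_split_head[OF sm] by simp
  also have "(\<lambda>j. (1/2)^Suc (Suc j) * a (Suc j)) = (\<lambda>j. 1/2 * ((1/2)^Suc j * a (Suc j)))"
    by simp
  also have "(\<Sum>j. 1/2 * ((1/2)^Suc j * a (Suc j))) = 1/2 * (\<Sum>j. (1/2)^Suc j * a (Suc j))"
    by (rule suminf_mult) (rule summable, rule assms)
  finally show "(\<Sum>j. (1/2)^Suc j * a j) = a 0 / 2 + (\<Sum>j. (1/2)^Suc j * a (Suc j)) / 2"
    by simp
qed

context
  fixes W :: "'w::t2_space set"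
  assumes compact_W: "compact W" and W_ne: "W \<noteq> {}"
begin

text \<open>Simons' argument: \<open>g n\<close> almost minimizes \<open>sup (h n + 2^-n g)\<close>, which forces the averages
  \<open>T n\<close> of the tail of \<open>g\<close> to be almost increasing at a point where \<open>T 0\<close> attains its maximum.\<close>
lemma simons_boundary:
  assumes E: "subspace E" "E \<subseteq> contf W"
    and F: "\<And>n. F n \<in> E" "\<And>n w. w \<in> W \<Longrightarrow> \<bar>F n w\<bar> \<le> C"
    and B: "\<And>f. f \<in> uniform_closure W E \<Longrightarrow> \<exists>b\<in>W. f b = supw W f \<and> (\<lambda>n. F n b) \<longlonglongrightarrow> 0"
    and w0: "w0 \<in> W" and \<delta>: "\<delta> > 0" "\<And>n. \<delta> \<le> F n w0"
  shows False
proof -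
  define V where "V = uniform_closure W E"
  have V: "subspace V" "V \<subseteq> contf W" "E \<subseteq> V"
    unfolding V_def
    by (rule subspace_uniform_closure[OF E(1)] uniform_closure_contf[OF E(2)]
      subset_uniform_closure)+
  define D where "D n = {g \<in> V. between_tails W F n g}" for n
  have DF: "F n \<in> D n" for n using F(1) V(3) between_tails_self by (auto simp: D_def)
  have Dmono: "g \<in> D m" if "g \<in> D n" "m \<le> n" for g m n
    using that between_tails_mono[of W F n g m] by (auto simp: D_def)
  have Dbd: "\<bar>g w\<bar> \<le> C" if g: "g \<in> D n" and w: "w \<in> W" for g n w
  proof -
    have bt: "between_tails W F n g" using g by (simp add: D_def)
    have "g w \<le> C" by (rule between_tails_upper[OF bt w]) (use F(2)[OF w] in \<open>auto simp: abs_le_iff\<close>)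
    moreover have "- C \<le> g w"
    proof (rule between_tails_lower[OF bt w])
      show "- C \<le> F k w" for k using F(2)[OF w, of k] by linarith
    qed
    ultimately show ?thesis by linarith
  qed
  \<comment> \<open>Dividing the error by \<open>(1/2)^n\<close> leaves
    \<open>\<delta> / 4 * (1/2)^n\<close>, and these sum to \<open>\<delta> / 2\<close>.\<close>
  define \<epsilon> where "\<epsilon> n = \<delta> / 4 * (1/4)^n" for n :: nat
  have \<epsilon>: "\<epsilon> n > 0" for n using \<delta>(1) by (simp add: \<epsilon>_def)
  define near_min where "near_min n h g \<longleftrightarrow> g \<in> D n \<and>
    (\<forall>g'\<in>D n. supw W (h + (1/2)^n *\<^sub>R g) \<le> supw W (h + (1/2)^n *\<^sub>R g') + \<epsilon> n)" for n h g
  have ex_near_min: "\<exists>g. near_min n h g" if h: "h \<in> V" for n h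
  proof -
    define S where "S = (\<lambda>g. supw W (h + (1/2)^n *\<^sub>R g)) ` D n"
    have "bdd_below S"
      unfolding S_def
    proof (rule bdd_belowI2)
      fix g assume g: "g \<in> D n"
      have "h + (1/2)^n *\<^sub>R g \<in> V" using h g V(1) by (auto simp: D_def intro: subspace_add subspace_scale)
      then have "(h + (1/2)^n *\<^sub>R g) w0 \<le> supw W (h + (1/2)^n *\<^sub>R g)"
        using subsetD[OF V(2)] w0 by (intro le_supw[OF compact_W W_ne])
      moreover have "(1/2)^n * (- C) \<le> (1/2)^n * g w0"
        using Dbd[OF g w0] by (intro mult_left_mono) (auto simp: abs_le_iff)
      ultimately show "h w0 + (1/2)^n * (- C) \<le> supw W (h + (1/2)^n *\<^sub>R g)" by simp
    qed
    moreover have "S \<noteq> {}" using DF by (auto simp: S_def)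
    ultimately obtain s where s: "s \<in> S" "s < Inf S + \<epsilon> n"
      using cInf_lessD[of S "Inf S + \<epsilon> n"] \<epsilon>[of n] by auto
    then obtain g where g: "g \<in> D n" "s = supw W (h + (1/2)^n *\<^sub>R g)" by (auto simp: S_def)
    have "supw W (h + (1/2)^n *\<^sub>R g) \<le> supw W (h + (1/2)^n *\<^sub>R g') + \<epsilon> n" if "g' \<in> D n" for g'
    proof -
      have "Inf S \<le> supw W (h + (1/2)^n *\<^sub>R g')"
        using \<open>bdd_below S\<close> that by (intro cInf_lower) (auto simp: S_def)
      then show ?thesis using s(2) g(2) by linarith
    qed
    then show ?thesis using g(1) unfolding near_min_def by blast
  qed
  \<comment> \<open>Here \<open>h n\<close> is the partial sum of the weighted series. The weight
    not yet spent is \<open>(1/2)^n\<close>, the coefficient in \<open>near_min\<close>; half of it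
    goes to the chosen \<open>g\<close>, hence \<open>(1/2)^Suc n\<close>.\<close>
  have "\<exists>h. \<forall>n. (h n \<in> V \<and> (n = 0 \<longrightarrow> h n = 0)) \<and>
    (\<exists>g. near_min n (h n) g \<and> h (Suc n) = h n + (1/2)^Suc n *\<^sub>R g)"
  proof (rule dependent_nat_choice)
    show "\<exists>h. h \<in> V \<and> (0 = (0::nat) \<longrightarrow> h = 0)" using subspace_0[OF V(1)] by blast
    fix h and n :: nat assume h: "h \<in> V \<and> (n = 0 \<longrightarrow> h = 0)"
    then obtain g where g: "near_min n h g" using ex_near_min by blast
    have "h + (1/2)^Suc n *\<^sub>R g \<in> V"
      using h g V(1) by (intro subspace_add subspace_scale) (auto simp: near_min_def D_def)
    then show "\<exists>h'. (h' \<in> V \<and> (Suc n = 0 \<longrightarrow> h' = 0)) \<and>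
      (\<exists>g. near_min n h g \<and> h' = h + (1/2)^Suc n *\<^sub>R g)"
      using g by blast
  qed
  then obtain h where h: "h 0 = 0" "\<And>n. \<exists>g. near_min n (h n) g \<and> h (Suc n) = h n + (1/2)^Suc n *\<^sub>R g"
    by blast
  obtain g where g: "\<And>n. near_min n (h n) (g n)" "\<And>n. h (Suc n) = h n + (1/2)^Suc n *\<^sub>R g n"
    using h(2) by metis
  have gD: "g n \<in> D n" for n using g(1)[of n] by (simp add: near_min_def)
  have gV: "g n \<in> V" for n using gD[of n] by (simp add: D_def)
  have gbd: "\<bar>g n w\<bar> \<le> C" if "w \<in> W" for n w by (rule Dbd[OF gD that])
  define T where "T n w = (\<Sum>j. (1/2)^Suc j * g (n + j) w)" for n w
  have TD: "T n \<in> D n" for n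
  proof -
    have gjD: "g (n + j) \<in> D n" for j by (rule Dmono[OF gD]) simp
    have "T n \<in> V"
      unfolding V_def T_def[abs_def]
      by (rule uniform_closure_series[OF E(1), of "\<lambda>j. g (n + j)" W C])
        (use gjD gbd in \<open>auto simp: D_def V_def\<close>)
    moreover have "between_tails W F n (T n)"
      unfolding between_tails_def
    proof (intro ballI allI conjI impI)
      fix w c assume w: "w \<in> W"
      have bt: "between_tails W F n (g (n + j))" for j using gjD[of j] by (simp add: D_def)
      show "T n w \<le> c" if "\<forall>k\<ge>n. F k w \<le> c"
        unfolding T_def using between_tails_upper[OF bt w] that
        by (intro half_series_le[of "\<lambda>j. g (n + j) w" C, OF gbd[OF w]]) blast
      show "c \<le> T n w" if "\<forall>k\<ge>n. c \<le> F k w"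
        unfolding T_def using between_tails_lower[OF bt w] that
        by (intro half_series_ge[of "\<lambda>j. g (n + j) w" C, OF gbd[OF w]]) blast
    qed
    ultimately show ?thesis by (simp add: D_def)
  qed
  have Tsplit: "T n w = g n w / 2 + T (Suc n) w / 2" if "w \<in> W" for n w
    unfolding T_def using half_series_split[of "\<lambda>j. g (n + j) w" C, OF gbd[OF that]] by simp
  have hT: "h n w + (1/2)^n * T n w = T 0 w" if w: "w \<in> W" for n w
  proof (induction n)
    case (Suc n)
    have "h (Suc n) w + (1/2)^Suc n * T (Suc n) w = h n w + (1/2)^n * (g n w / 2 + T (Suc n) w / 2)"
      by (simp add: g(2) algebra_simps)
    also have "\<dots> = T 0 w" using Suc Tsplit[OF w, of n] by simp
    finally show ?case .
  qed (simp add: h(1))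
  have hV: "h n + (1/2)^n *\<^sub>R g n \<in> contf W" for n
  proof -
    have "h n \<in> V"
    proof (induction n)
      case 0
      show ?case unfolding h(1) by (rule subspace_0[OF V(1)])
    next
      case (Suc n)
      show ?case unfolding g(2)
        by (rule subspace_add[OF V(1) Suc subspace_scale[OF V(1) gV]])
    qed
    then have "h n + (1/2)^n *\<^sub>R g n \<in> V"
      by (rule subspace_add[OF V(1) _ subspace_scale[OF V(1) gV]])
    then show ?thesis by (rule subsetD[OF V(2)])
  qed
  have T0V: "T 0 \<in> V" using TD[of 0] by (simp add: D_def)
  obtain b where b: "b \<in> W" "T 0 b = supw W (T 0)" "(\<lambda>n. F n b) \<longlonglongrightarrow> 0"
    using B T0V unfolding V_def by blast
  \<comment> \<open>The competitor for \<open>g n\<close> is \<open>T n\<close> itself: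
    \<open>h n + (1/2)^n T n\<close> is \<open>T 0\<close>, whose supremum is attained at
    \<open>b\<close>, so near-minimality compares \<open>g n b\<close> with
    \<open>T n b\<close>.\<close>
  have step: "T n b \<le> T (Suc n) b + \<delta> / 4 * (1/2)^n" for n
  proof -
    have "h n b + (1/2)^n * g n b \<le> supw W (h n + (1/2)^n *\<^sub>R g n)"
      using le_supw[OF compact_W W_ne hV[of n] b(1)] by simp
    also have "\<dots> \<le> supw W (h n + (1/2)^n *\<^sub>R T n) + \<epsilon> n"
      using g(1)[of n] TD[of n] by (simp add: near_min_def)
    also have "supw W (h n + (1/2)^n *\<^sub>R T n) = supw W (T 0)"
      by (rule supw_cong[OF compact_W W_ne]) (use hT in simp)
    also have "\<dots> = h n b + (1/2)^n * T n b" using b(2) hT[OF b(1)] by simp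
    finally have "(1/2)^n * g n b \<le> (1/2)^n * (T n b + \<delta> / 4 * (1/2)^n)"
      by (simp add: \<epsilon>_def algebra_simps power_mult_distrib[symmetric])
    then have "g n b \<le> T n b + \<delta> / 4 * (1/2)^n" by simp
    then show ?thesis using Tsplit[OF b(1), of n] by linarith
  qed
  have "T 0 b \<le> T n b + \<delta> / 2 * (1 - (1/2)^n)" for n
  proof (induction n)
    case (Suc n)
    have "T 0 b \<le> T (Suc n) b + \<delta> / 4 * (1/2)^n + \<delta> / 2 * (1 - (1/2)^n)"
      using Suc step[of n] by linarith
    also have "\<dots> = T (Suc n) b + \<delta> / 2 * (1 - (1/2)^Suc n)"
      by (simp add: field_simps)
    finally show ?case .
  qed simp
  moreover have "\<delta> / 2 * (1 - (1/2)^n) \<le> \<delta> / 2" for n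
    using \<delta>(1) by (simp add: field_simps)
  ultimately have T0le: "T 0 b \<le> T n b + \<delta> / 2" for n by (smt (verit))
  have bt: "between_tails W F n (T n)" for n using TD[of n] by (simp add: D_def)
  have "\<delta> \<le> T 0 w0" by (rule between_tails_lower[OF bt w0 \<delta>(2)])
  also have "T 0 w0 \<le> T 0 b"
    unfolding b(2) by (rule le_supw[OF compact_W W_ne subsetD[OF V(2) T0V] w0])
  finally have ge: "\<delta> / 2 \<le> T n b" for n using T0le[of n] by linarith
  \<comment> \<open>Convergence at \<open>b\<close> pushes the tail averages down to
    \<open>\<delta> / 4\<close>, against the lower bound \<open>\<delta> / 2\<close> in
    \<open>ge\<close>.\<close>
  have "\<forall>\<^sub>F k in sequentially. F k b < \<delta> / 4"
    using \<delta>(1) by (intro order_tendstoD(2)[OF b(3)]) simp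
  then obtain n where n: "\<And>k. k \<ge> n \<Longrightarrow> F k b < \<delta> / 4"
    unfolding eventually_sequentially by blast
  have "T n b \<le> \<delta> / 4" by (rule between_tails_upper[OF bt b(1) less_imp_le[OF n]])
  then show False using ge[of n] \<delta>(1) by linarith
qed

text \<open>Failure at \<open>w\<close> leaves, up to a sign \<open>s\<close>, a subsequence that is
  at least \<open>\<delta>\<close> there. Each function in the closure attains its supremum at an
  extreme point, where the signed subsequence still tends to 0, so Simons' argument applies.\<close>

theorem tendsto_zero_of_extreme_pts:
  assumes E: "subspace E" "E \<subseteq> contf W"
    and F: "\<And>n. F n \<in> E" "\<And>n w. w \<in> W \<Longrightarrow> \<bar>F n w\<bar> \<le> C"
    and ext: "\<And>w. extreme_pt W E w \<Longrightarrow> (\<lambda>n. F n w) \<longlonglongrightarrow> 0"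
    and w: "w \<in> W"
  shows "(\<lambda>n. F n w) \<longlonglongrightarrow> 0"
proof (rule ccontr)
  assume "\<not> ?thesis"
  then obtain \<delta> where \<delta>: "\<delta> > 0" "\<And>N. \<exists>n\<ge>N. \<delta> \<le> \<bar>F n w\<bar>"
    unfolding LIMSEQ_def by (auto simp: dist_real_def not_less)
  have flip: "\<exists>n\<ge>N. \<delta> \<le> - F n w" if M: "\<And>n. n \<ge> M \<Longrightarrow> F n w < \<delta>" for M N
  proof -
    obtain n where n: "n \<ge> max M N" "\<delta> \<le> \<bar>F n w\<bar>" using \<delta>(2) by blast
    then have "\<delta> \<le> - F n w" using M[of n] by (auto simp: abs_if split: if_splits)
    then show ?thesis using n by auto
  qed
  obtain s where s: "s = 1 \<or> s = (-1::real)" "\<And>N. \<exists>n\<ge>N. \<delta> \<le> s * F n w"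
  proof (cases "\<exists>M. \<forall>n\<ge>M. F n w < \<delta>")
    case True
    then show thesis using flip by (intro that[of "-1"]) auto
  next
    case False
    then show thesis by (intro that[of 1]) (auto simp: not_less)
  qed
  have "infinite {n. \<delta> \<le> s * F n w}"
    unfolding infinite_nat_iff_unbounded_le using s(2) by simp
  from infinite_enumerate[OF this]
  obtain r :: "nat \<Rightarrow> nat" where r: "strict_mono r" "\<And>n. \<delta> \<le> s * F (r n) w" by blast
  define G where "G n = s *\<^sub>R F (r n)" for n
  show False
  proof (rule simons_boundary[OF E, of G C w \<delta>])
    show "G n \<in> E" for n unfolding G_def using F(1) E(1) by (intro subspace_scale)
    show "\<bar>G n w\<bar> \<le> C" if "w \<in> W" for n w
      using F(2)[OF that, of "r n"] s(1) by (auto simp: G_def)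
    show "w \<in> W" "\<delta> > 0" by fact+
    show "\<delta> \<le> G n w" for n using r(2)[of n] by (simp add: G_def)
    fix f assume f: "f \<in> uniform_closure W E"
    obtain b where b: "extreme_pt W (uniform_closure W E) b" "f b = supw W f"
      using sup_attained_at_extreme_pt[OF compact_W W_ne subspace_uniform_closure[OF E(1)]
        uniform_closure_contf[OF E(2)] f] by blast
    have "(\<lambda>n. F n b) \<longlonglongrightarrow> 0"
      by (rule ext[OF extreme_pt_uniform_closure[OF compact_W W_ne E b(1)]])
    then have "(\<lambda>n. s * F (r n) b) \<longlonglongrightarrow> s * 0"
      by (intro tendsto_mult_left) (use LIMSEQ_subseq_LIMSEQ[OF _ r(1)] in \<open>simp add: o_def\<close>)
    then show "\<exists>b\<in>W. f b = supw W f \<and> (\<lambda>n. G n b) \<longlonglongrightarrow> 0"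
      using b by (auto simp: G_def extreme_pt_def)
  qed
qed

end

section \<open>Real and complex scalars\<close>

text \<open>The real part of a scalar \<open>x\<close> is \<open>x \<bullet> 1\<close> and its conjugate is \<open>2 (x \<bullet> 1) - x\<close>. The element \<open>j\<close>
  is the imaginary unit over the complex numbers and \<open>0\<close> over the reals.\<close>
class rc_scalar = real_normed_field + euclidean_space + ord +
  assumes inner_eq_conj: "x \<bullet> y = (x * ((2 * (y \<bullet> 1)) *\<^sub>R 1 - y)) \<bullet> 1"
    and nonneg_iff_scaleR: "0 \<le> x \<longleftrightarrow> 0 \<le> x \<bullet> 1 \<and> x = (x \<bullet> 1) *\<^sub>R 1"
    and imaginary_unit_scaleR: "\<exists>j. j \<bullet> 1 = 0 \<and> (\<forall>x. x = (x \<bullet> 1) *\<^sub>R 1 + ((- j * x) \<bullet> 1) *\<^sub>R j)"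

instance real :: rc_scalar
  by standard (auto intro!: exI[of _ 0])

instance complex :: rc_scalar
proof
  fix x y :: complex
  show "x \<bullet> y = (x * ((2 * (y \<bullet> 1)) *\<^sub>R 1 - y)) \<bullet> 1"
    by (simp add: inner_complex_def algebra_simps)
  show "0 \<le> x \<longleftrightarrow> 0 \<le> x \<bullet> 1 \<and> x = (x \<bullet> 1) *\<^sub>R 1"
    by (auto simp: less_eq_complex_def complex_eq_iff inner_complex_def)
  show "\<exists>j::complex. j \<bullet> 1 = 0 \<and> (\<forall>x. x = (x \<bullet> 1) *\<^sub>R 1 + ((- j * x) \<bullet> 1) *\<^sub>R j)"
    by (rule exI[of _ \<i>]) (simp add: inner_complex_def complex_eq_iff)
qed

abbreviation re :: "'k::rc_scalar \<Rightarrow> real" where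
  "re x \<equiv> x \<bullet> 1"

definition sconj :: "'k::rc_scalar \<Rightarrow> 'k" where
  "sconj y = of_real (2 * re y) - y"

lemma inner_sconj: "x \<bullet> y = re (x * sconj y)"
  unfolding sconj_def of_real_def by (rule inner_eq_conj)

lemma nonneg_iff: "0 \<le> (x :: 'k::rc_scalar) \<longleftrightarrow> 0 \<le> re x \<and> x = of_real (re x)"
  unfolding of_real_def by (rule nonneg_iff_scaleR)

lemma imaginary_unit:
  "\<exists>j::'k::rc_scalar. re j = 0 \<and> (\<forall>x. x = of_real (re x) + of_real (re (- j * x)) * j)"
  using imaginary_unit_scaleR unfolding of_real_def mult_scaleR_left mult_1_left .

lemma re_of_real [simp]: "re (of_real r :: 'k::rc_scalar) = r"
  by (simp add: of_real_def dot_square_norm)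

lemma re_of_real_mult [simp]: "re (of_real r * x) = r * re x"
  by (simp flip: scaleR_conv_of_real)

lemma re_one [simp]: "re (1 :: 'k::rc_scalar) = 1"
  by (simp add: dot_square_norm)

lemma abs_re_le: "\<bar>re x\<bar> \<le> norm x"
  using Cauchy_Schwarz_ineq2[of x 1] by simp

lemma re_le_norm: "re x \<le> norm x"
  using abs_re_le[of x] by simp

text \<open>Conjugation is the reflection in the line of real scalars, hence an isometry.\<close>

lemma norm_sconj [simp]: "norm (sconj y) = norm (y :: 'k::rc_scalar)"
proof -
  have one: "1 \<bullet> (1::'k) = 1" by (rule re_one)
  have "sconj y \<bullet> sconj y = (2 * re y) * (2 * re y) - 2 * (2 * re y) * re y + y \<bullet> y"
    unfolding sconj_def of_real_def inner_diff_left inner_diff_right inner_scaleR_left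
      inner_scaleR_right inner_commute[of 1 y] one by algebra
  then have "sconj y \<bullet> sconj y = y \<bullet> y" by simp
  then show ?thesis unfolding norm_eq_sqrt_inner by (rule arg_cong)
qed

text \<open>Multiplying by the conjugate of a basis vector turns a coordinate into a real part, so
  scalar identities reduce to real ones.\<close>

lemma re_mult_unit_eqI:
  assumes "\<And>c::'k::rc_scalar. norm c = 1 \<Longrightarrow> re (c * x) = re (c * y)"
  shows "x = y"
proof (rule euclidean_eqI)
  fix b :: 'k assume b: "b \<in> Basis"
  have "re (sconj b * x) = re (sconj b * y)"
    by (rule assms) (use b in simp)
  then show "x \<bullet> b = y \<bullet> b"
    unfolding inner_sconj[of x b] inner_sconj[of y b] by (simp add: mult.commute)
qed

lemma tendsto_re_mult_unitI:
  fixes l :: "'k::rc_scalar"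
  assumes "\<And>c::'k. norm c = 1 \<Longrightarrow> ((\<lambda>n. re (c * f n)) \<longlongrightarrow> re (c * l)) F"
  shows "(f \<longlongrightarrow> l) F"
proof (subst tendsto_componentwise_iff, rule ballI)
  fix b :: 'k assume b: "b \<in> Basis"
  have "((\<lambda>n. re (sconj b * f n)) \<longlongrightarrow> re (sconj b * l)) F"
    by (rule assms) (use b in simp)
  then show "((\<lambda>n. f n \<bullet> b) \<longlongrightarrow> l \<bullet> b) F"
    by (simp add: inner_sconj[of _ b] mult.commute)
qed

lemma unit_rotation:
  fixes x :: "'k::rc_scalar"
  obtains c :: 'k where "norm c = 1" "c * x = of_real (norm x)"
proof (cases "x = 0")
  case True
  then show thesis using that[of 1] by simp
next
  case False
  then show thesis using that[of "of_real (norm x) / x"] by (simp add: norm_divide)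
qed

lemma functional_on_scalar_repr:
  fixes A :: "'k::rc_scalar \<Rightarrow> real"
  assumes "functional_on UNIV A"
  shows "\<exists>w. \<forall>c. A c = re (c * w)"
proof -
  define u where "u = (\<Sum>b\<in>Basis. A b *\<^sub>R (b::'k))"
  have "A c = re (c * sconj u)" for c
  proof -
    have "c = (\<Sum>b\<in>Basis. (c \<bullet> b) *\<^sub>R b)" by (simp add: euclidean_representation)
    then have "A c = A (\<Sum>b\<in>Basis. (c \<bullet> b) *\<^sub>R b)" by simp
    also have "\<dots> = (\<Sum>b\<in>Basis. A ((c \<bullet> b) *\<^sub>R b))"
      by (rule functional_on_sum[OF assms]) auto
    also have "\<dots> = c \<bullet> u"
      unfolding u_def inner_sum_right inner_scaleR_right
      using assms by (intro sum.cong) (simp_all add: functional_on_def)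
    finally show ?thesis unfolding inner_sconj[of c u] .
  qed
  then show ?thesis by blast
qed

section \<open>Spaces of scalar-valued continuous functions\<close>

lemma lin_subspace_kspan: "lin_subspace (kspan B)"
  unfolding kspan_def lin_subspace_def by blast

lemma kspan_superset: "B \<subseteq> kspan B"
  unfolding kspan_def by blast

lemma kspan_minimal: "lin_subspace A \<Longrightarrow> B \<subseteq> A \<Longrightarrow> kspan B \<subseteq> A"
  unfolding kspan_def by blast

lemma kspan_lin_subspace: "lin_subspace A \<Longrightarrow> kspan A = A"
  using kspan_minimal[of A A] kspan_superset[of A] by blast

lemma lin_subspace_CC: "lin_subspace CC"
  unfolding lin_subspace_def CC_def by (auto intro!: continuous_intros)

lemma lin_subspace_zero: "lin_subspace A \<Longrightarrow> (\<lambda>_. 0) \<in> A"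
  by (simp add: lin_subspace_def)

lemma lin_subspace_scale: "lin_subspace A \<Longrightarrow> f \<in> A \<Longrightarrow> (\<lambda>z. c * f z) \<in> A"
  by (simp add: lin_subspace_def)

lemma lin_subspace_lincomb:
  assumes "lin_subspace A" "f \<in> A" "g \<in> A"
  shows "(\<lambda>z. a * f z + b * g z) \<in> A"
  using assms unfolding lin_subspace_def by auto

lemma lin_subspace_diff:
  assumes "lin_subspace A" "f \<in> A" "g \<in> A"
  shows "(\<lambda>z. f z - g z) \<in> A"
  using lin_subspace_lincomb[OF assms, of 1 "-1"] by simp

lemma scaleR_fun_conv: "r *\<^sub>R f = (\<lambda>z. of_real r * (f z :: 'k::real_normed_field))"
  by (simp add: fun_eq_iff scaleR_conv_of_real)

lemma plus_fun_conv: "f + g = (\<lambda>z. f z + g z)"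
  by (simp add: fun_eq_iff)

lemma bdd_above_norm_CC:
  fixes f :: "'z::topological_space \<Rightarrow> 'k::real_normed_field"
  assumes "compact (UNIV :: 'z set)" "f \<in> CC"
  shows "bdd_above (range (\<lambda>z. norm (f z)))"
proof -
  have "bounded (range f)"
    using assms by (intro compact_imp_bounded compact_continuous_image) (auto simp: CC_def)
  then obtain K where "\<And>z. norm (f z) \<le> K" by (auto simp: bounded_iff)
  then show ?thesis by (intro bdd_aboveI2)
qed

lemma norm_le_supn:
  fixes f :: "'z::topological_space \<Rightarrow> 'k::real_normed_field"
  assumes "compact (UNIV :: 'z set)" "f \<in> CC"
  shows "norm (f z) \<le> supn f"
  unfolding supn_def by (rule cSUP_upper[OF UNIV_I bdd_above_norm_CC[OF assms]])

lemma supn_least: "(\<And>z. norm (f z) \<le> c) \<Longrightarrow> supn f \<le> c"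
  unfolding supn_def by (rule cSUP_least) auto

lemma supn_unit_mult: "norm c = 1 \<Longrightarrow> supn (\<lambda>z. c * f z) = supn f"
  by (simp add: supn_def norm_mult)

text \<open>A real functional \<open>a\<close> is the real part of a unique scalar-linear functional \<open>\<phi>\<close>; the value
  \<open>\<phi> f\<close> represents \<open>c \<mapsto> a (c f)\<close>.\<close>
lemma dual_ball_of_real_functional:
  fixes A :: "('z::topological_space \<Rightarrow> 'k::rc_scalar) set"
  assumes A: "lin_subspace A" and a: "functional_on A a" "\<And>f. f \<in> A \<Longrightarrow> a f \<le> supn f"
  shows "\<exists>\<phi>\<in>dual_ball A. \<forall>f\<in>A. \<forall>c. re (c * \<phi> f) = a (\<lambda>z. c * f z)"
proof -
  have add: "a (\<lambda>z. f z + g z) = a f + a g" if "f \<in> A" "g \<in> A" for f g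
    using a(1) that unfolding functional_on_def plus_fun_conv by blast
  have "\<exists>w. \<forall>c. a (\<lambda>z. c * f z) = re (c * w)" if f: "f \<in> A" for f
  proof (rule functional_on_scalar_repr)
    have cf: "(\<lambda>z. c * f z) \<in> A" for c by (rule lin_subspace_scale[OF A f])
    show "functional_on UNIV (\<lambda>c. a (\<lambda>z. c * f z))"
      unfolding functional_on_def
    proof (intro conjI ballI allI)
      show "a (\<lambda>z. (u + v) * f z) = a (\<lambda>z. u * f z) + a (\<lambda>z. v * f z)" for u v
        using add[OF cf[of u] cf[of v]] by (simp add: distrib_right)
      show "a (\<lambda>z. (r *\<^sub>R u) * f z) = r * a (\<lambda>z. u * f z)" for r u
      proof -
        have "a (r *\<^sub>R (\<lambda>z. u * f z)) = r * a (\<lambda>z. u * f z)"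
          using a(1) cf[of u] unfolding functional_on_def by blast
        then show ?thesis by (simp add: scaleR_fun_def)
      qed
    qed
  qed
  then have "\<forall>f. \<exists>w. f \<in> A \<longrightarrow> (\<forall>c. re (c * w) = a (\<lambda>z. c * f z))" by metis
  then obtain \<phi> where \<phi>: "\<And>f c. f \<in> A \<Longrightarrow> re (c * \<phi> f) = a (\<lambda>z. c * f z)" by metis
  have "\<phi> \<in> dual_ball A"
    unfolding dual_ball_def
  proof (intro CollectI conjI ballI allI)
    fix f g \<alpha> \<beta> assume fg: "f \<in> A" "g \<in> A"
    show "\<phi> (\<lambda>z. \<alpha> * f z + \<beta> * g z) = \<alpha> * \<phi> f + \<beta> * \<phi> g"
    proof (rule re_mult_unit_eqI)
      fix c :: 'k
      have "re (c * \<phi> (\<lambda>z. \<alpha> * f z + \<beta> * g z)) = a (\<lambda>z. c * (\<alpha> * f z + \<beta> * g z))"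
        by (rule \<phi>[OF lin_subspace_lincomb[OF A fg]])
      also have "(\<lambda>z. c * (\<alpha> * f z + \<beta> * g z)) = (\<lambda>z. c * \<alpha> * f z + c * \<beta> * g z)"
        by (simp add: algebra_simps)
      also have "a \<dots> = re (c * \<alpha> * \<phi> f) + re (c * \<beta> * \<phi> g)"
        using add[OF lin_subspace_scale[OF A fg(1)] lin_subspace_scale[OF A fg(2)]] fg
        by (simp add: \<phi>)
      finally show "re (c * \<phi> (\<lambda>z. \<alpha> * f z + \<beta> * g z)) = re (c * (\<alpha> * \<phi> f + \<beta> * \<phi> g))"
        by (simp add: algebra_simps inner_add_left)
    qed
  next
    fix f assume f: "f \<in> A"
    obtain c :: 'k where c: "norm c = 1" "c * \<phi> f = of_real (norm (\<phi> f))"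
      by (rule unit_rotation)
    have "norm (\<phi> f) = re (c * \<phi> f)" by (simp add: c(2))
    also have "\<dots> \<le> supn (\<lambda>z. c * f z)"
      unfolding \<phi>[OF f] by (rule a(2)[OF lin_subspace_scale[OF A f]])
    finally show "norm (\<phi> f) \<le> supn f" by (simp add: supn_unit_mult[OF c(1)])
  qed
  then show ?thesis using \<phi> by blast
qed

lemma dual_ball_lincomb:
  "\<phi> \<in> dual_ball A \<Longrightarrow> f \<in> A \<Longrightarrow> g \<in> A \<Longrightarrow> \<phi> (\<lambda>z. a * f z + b * g z) = a * \<phi> f + b * \<phi> g"
  by (simp add: dual_ball_def)

lemma dual_ball_scale:
  assumes "\<phi> \<in> dual_ball A" "f \<in> A"
  shows "\<phi> (\<lambda>z. a * f z) = a * \<phi> f"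
  using dual_ball_lincomb[OF assms assms(2), of a 0] by simp

lemma dual_ball_diff:
  assumes "\<phi> \<in> dual_ball A" "f \<in> A" "g \<in> A"
  shows "\<phi> (\<lambda>z. f z - g z) = \<phi> f - \<phi> g"
  using dual_ball_lincomb[OF assms, of 1 "-1"] by simp

lemma dual_ball_norm: "\<phi> \<in> dual_ball A \<Longrightarrow> f \<in> A \<Longrightarrow> norm (\<phi> f) \<le> supn f"
  by (simp add: dual_ball_def)

lemma dual_extremeD:
  assumes "dual_extreme A \<psi>" "\<phi>1 \<in> dual_ball A" "\<phi>2 \<in> dual_ball A" "0 < t" "t < 1"
    "\<And>f. f \<in> A \<Longrightarrow> \<psi> f = of_real t * \<phi>1 f + of_real (1 - t) * \<phi>2 f" "f \<in> A"
  shows "\<phi>1 f = \<phi>2 f"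
  using assms unfolding dual_extreme_def by blast

lemma continuous_on_re: "f \<in> CC \<Longrightarrow> continuous_on W (\<lambda>x. re (f x))"
  unfolding CC_def by (auto intro!: continuous_intros intro: continuous_on_subset)

text \<open>The assumption \<open>le\<close> makes the real part of \<open>\<phi>\<close> a minorant
  \<open>q\<close> of the supremum on the real parts of \<open>S\<close>. A decomposition of
  \<open>q\<close> complexifies to one of \<open>\<phi>\<close>, so \<open>q\<close> is extreme and
  the results on real minorants apply; rotating by scalars recovers \<open>\<phi>\<close>
  itself.\<close>

lemma dual_extreme_eval_sandwich:
  fixes S :: "('a::t2_space \<Rightarrow> 'k::rc_scalar) set"
  assumes cpt: "compact (UNIV :: 'a set)" and S: "function_space S"
    and ext: "dual_extreme S \<phi>"
    and le: "\<And>s c. s \<in> S \<Longrightarrow> (\<And>x. re (s x) \<le> c) \<Longrightarrow> re (\<phi> s) \<le> c"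
  obtains x where "\<And>s. s \<in> S \<Longrightarrow> \<phi> s = s x"
    "\<And>f \<epsilon>. continuous_on UNIV f \<Longrightarrow> \<epsilon> > 0 \<Longrightarrow>
      \<exists>s\<in>S. (\<forall>v. f v \<le> re (s v)) \<and> re (s x) < f x + \<epsilon>"
proof -
  have lin: "lin_subspace S" and SC: "S \<subseteq> CC" and one: "(\<lambda>_. 1) \<in> S"
    and sep: "\<And>x y. x \<noteq> y \<Longrightarrow> \<exists>f\<in>S. f x \<noteq> f y"
    using S by (auto simp: function_space_def)
  have \<phi>: "\<phi> \<in> dual_ball S" using ext by (simp add: dual_extreme_def)
  define R where "R s = (\<lambda>x. re (s x))" for s :: "'a \<Rightarrow> 'k"
  define E where "E = R ` S"
  define q where "q e = re (\<phi> (inv_into S R e))" for e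
  have R_add: "R s + R s' = R (\<lambda>x. 1 * s x + 1 * s' x)" for s s'
    by (simp add: R_def fun_eq_iff inner_add_left)
  have R_scale: "r *\<^sub>R R s = R (\<lambda>x. of_real r * s x)" for r s
    by (simp add: R_def fun_eq_iff)
  have RS: "R s \<in> contf UNIV" if "s \<in> S" for s
    unfolding R_def contf_def using continuous_on_re that SC by blast
  have E: "subspace E" "E \<subseteq> contf UNIV"
  proof -
    show "subspace E"
      unfolding subspace_def
    proof (intro conjI ballI allI)
      have "(0 :: 'a \<Rightarrow> real) = R (\<lambda>_. 0)" by (simp add: R_def fun_eq_iff)
      then show "0 \<in> E" using lin_subspace_zero[OF lin] by (simp add: E_def)
      show "e + e' \<in> E" if "e \<in> E" "e' \<in> E" for e e'
      proof -
        obtain s s' where ss: "s \<in> S" "e = R s" "s' \<in> S" "e' = R s'" using \<open>e \<in> E\<close> \<open>e' \<in> E\<close> by (auto simp: E_def)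
        show ?thesis
          unfolding ss E_def R_add by (rule imageI[OF lin_subspace_lincomb[OF lin ss(1,3)]])
      qed
      show "r *\<^sub>R e \<in> E" if "e \<in> E" for r e
      proof -
        obtain s where s: "s \<in> S" "e = R s" using \<open>e \<in> E\<close> by (auto simp: E_def)
        show ?thesis
          unfolding s E_def R_scale by (rule imageI[OF lin_subspace_scale[OF lin s(1)]])
      qed
    qed
    show "E \<subseteq> contf UNIV" using RS by (auto simp: E_def)
  qed
  have qR: "q (R s) = re (\<phi> s)" if s: "s \<in> S" for s
  proof -
    \<comment> \<open>That \<open>q\<close> is independent of the chosen preimage follows from
      \<open>le\<close> with \<open>c = 0\<close>, applied to differences in both orders.\<close>
    have same: "re (\<phi> s) \<le> re (\<phi> s')" if ss: "s \<in> S" "s' \<in> S" "R s = R s'" for s s'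
    proof -
      have "re (\<phi> (\<lambda>z. s z - s' z)) \<le> 0"
        using fun_cong[OF ss(3)]
        by (intro le lin_subspace_diff[OF lin ss(1,2)]) (simp add: R_def inner_diff_left)
      then show ?thesis by (simp add: dual_ball_diff[OF \<phi> ss(1,2)] inner_diff_left)
    qed
    have "inv_into S R (R s) \<in> S" "R (inv_into S R (R s)) = R s"
      using inv_into_into[OF imageI[OF s], of R] f_inv_into_f[OF imageI[OF s], of R] by simp_all
    then show ?thesis unfolding q_def using same s by (intro antisym) auto
  qed
  have q_ext: "extreme_minorant E (supw UNIV) q"
    unfolding extreme_minorant_def
  proof (intro conjI allI impI)
    show "minorant E (supw UNIV) q"
      unfolding minorant_def functional_on_def
    proof (intro conjI ballI allI)
      fix e e' assume "e \<in> E" "e' \<in> E"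
      then obtain s s' where ss: "s \<in> S" "e = R s" "s' \<in> S" "e' = R s'" by (auto simp: E_def)
      have "q (e + e') = re (\<phi> (\<lambda>x. 1 * s x + 1 * s' x))"
        unfolding ss R_add by (rule qR[OF lin_subspace_lincomb[OF lin ss(1,3)]])
      then show "q (e + e') = q e + q e'"
        unfolding dual_ball_lincomb[OF \<phi> ss(1,3)] by (simp add: ss qR inner_add_left)
    next
      fix e and r :: real assume "e \<in> E"
      then obtain s where s: "s \<in> S" "e = R s" by (auto simp: E_def)
      have "q (r *\<^sub>R e) = re (\<phi> (\<lambda>x. of_real r * s x))"
        unfolding s R_scale by (rule qR[OF lin_subspace_scale[OF lin s(1)]])
      then show "q (r *\<^sub>R e) = r * q e"
        unfolding dual_ball_scale[OF \<phi> s(1)] by (simp add: s qR)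
    next
      fix e assume "e \<in> E"
      then obtain s where s: "s \<in> S" "e = R s" by (auto simp: E_def)
      have "re (s x) \<le> supw UNIV (R s)" for x
        using le_supw[OF cpt UNIV_not_empty RS[OF s(1)] UNIV_I, of x] by (simp add: R_def)
      then show "q e \<le> supw UNIV e" unfolding s(2) qR[OF s(1)] by (rule le[OF s(1)])
    qed
    fix a b t
    assume H: "minorant E (supw UNIV) a \<and> minorant E (supw UNIV) b \<and> 0 < t \<and> t < 1 \<and>
      (\<forall>u\<in>E. q u = t * a u + (1 - t) * b u)"
    \<comment> \<open>Since the supremum of the real part is at most the norm, minorants on
      \<open>E\<close> lift to the dual ball of \<open>S\<close>.\<close>
    have complexify: "\<exists>\<psi>\<in>dual_ball S. \<forall>s\<in>S. \<forall>c. re (c * \<psi> s) = d (R (\<lambda>z. c * s z))"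
      if d: "minorant E (supw UNIV) d" for d
    proof (rule dual_ball_of_real_functional[OF lin])
      show "functional_on S (\<lambda>s. d (R s))"
        unfolding functional_on_def
      proof (intro conjI ballI allI)
        fix s s' assume ss: "s \<in> S" "s' \<in> S"
        have "d (R s + R s') = d (R s) + d (R s')"
          using d ss unfolding minorant_def functional_on_def E_def by blast
        then show "d (R (s + s')) = d (R s) + d (R s')"
          unfolding R_add by (simp add: plus_fun_conv)
      next
        fix s and r :: real assume s: "s \<in> S"
        have "d (r *\<^sub>R R s) = r * d (R s)"
          using d s unfolding minorant_def functional_on_def E_def by blast
        then show "d (R (r *\<^sub>R s)) = r * d (R s)"
          unfolding R_scale scaleR_fun_conv[of r s] .
      qed
      fix s assume s: "s \<in> S"
      have "d (R s) \<le> supw UNIV (R s)"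
        using d s unfolding minorant_def E_def by blast
      also have "\<dots> \<le> supn s"
      proof (rule supw_least[OF cpt UNIV_not_empty])
        fix x
        have "norm (s x) \<le> supn s" by (rule norm_le_supn[OF cpt subsetD[OF SC s]])
        then show "R s x \<le> supn s" unfolding R_def using re_le_norm[of "s x"] by linarith
      qed
      finally show "d (R s) \<le> supn s" .
    qed
    have Ha: "minorant E (supw UNIV) a" and Hb: "minorant E (supw UNIV) b" and t: "0 < t" "t < 1"
      and Hq: "\<And>u. u \<in> E \<Longrightarrow> q u = t * a u + (1 - t) * b u"
      using H by blast+
    obtain \<phi>a where \<phi>a: "\<phi>a \<in> dual_ball S" "\<And>s c. s \<in> S \<Longrightarrow> re (c * \<phi>a s) = a (R (\<lambda>z. c * s z))"
      using complexify[OF Ha] by blast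
    obtain \<phi>b where \<phi>b: "\<phi>b \<in> dual_ball S" "\<And>s c. s \<in> S \<Longrightarrow> re (c * \<phi>b s) = b (R (\<lambda>z. c * s z))"
      using complexify[OF Hb] by blast
    have mean: "\<phi> s = of_real t * \<phi>a s + of_real (1 - t) * \<phi>b s" if s: "s \<in> S" for s
    proof (rule re_mult_unit_eqI)
      fix c :: 'k
      have cs: "(\<lambda>z. c * s z) \<in> S" by (rule lin_subspace_scale[OF lin s])
      then have RE: "R (\<lambda>z. c * s z) \<in> E" by (simp add: E_def)
      have "re (c * \<phi> s) = q (R (\<lambda>z. c * s z))"
        unfolding qR[OF cs] dual_ball_scale[OF \<phi> s] ..
      also have "\<dots> = t * re (c * \<phi>a s) + (1 - t) * re (c * \<phi>b s)"
        unfolding Hq[OF RE] \<phi>a(2)[OF s] \<phi>b(2)[OF s] ..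
      also have "\<dots> = re (of_real t * (c * \<phi>a s) + of_real (1 - t) * (c * \<phi>b s))"
        by (simp only: inner_add_left re_of_real_mult)
      also have "of_real t * (c * \<phi>a s) + of_real (1 - t) * (c * \<phi>b s)
          = c * (of_real t * \<phi>a s + of_real (1 - t) * \<phi>b s)"
        by (simp only: distrib_left mult.left_commute)
      finally show "re (c * \<phi> s) = re (c * (of_real t * \<phi>a s + of_real (1 - t) * \<phi>b s))" .
    qed
    show "\<forall>u\<in>E. a u = b u"
    proof
      fix u assume "u \<in> E"
      then obtain s where s: "s \<in> S" "u = R s" by (auto simp: E_def)
      have "\<phi>a s = \<phi>b s" by (rule dual_extremeD[OF ext \<phi>a(1) \<phi>b(1) t mean s(1)])
      then show "a u = b u"
        using \<phi>a(2)[OF s(1), of 1] \<phi>b(2)[OF s(1), of 1] s(2) by simp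
    qed
  qed
  obtain x where x: "\<And>e. e \<in> E \<Longrightarrow> e x = q e"
    using extreme_minorant_eval[OF cpt UNIV_not_empty E q_ext] by blast
  have \<phi>x: "\<phi> s = s x" if s: "s \<in> S" for s
  proof (rule re_mult_unit_eqI)
    fix c :: 'k
    have cs: "(\<lambda>z. c * s z) \<in> S" by (rule lin_subspace_scale[OF lin s])
    have "R (\<lambda>z. c * s z) x = re (\<phi> (\<lambda>z. c * s z))"
      using x[of "R (\<lambda>z. c * s z)"] qR[OF cs] cs by (simp add: E_def)
    then show "re (c * \<phi> s) = re (c * s x)"
      unfolding dual_ball_scale[OF \<phi> s] by (simp add: R_def)
  qed
  have oneE: "(\<lambda>_. 1) \<in> E"
    unfolding E_def by (rule image_eqI[OF _ one]) (simp add: R_def)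
  have sepE: "\<exists>g\<in>E. g w \<noteq> g x" if wx: "w \<noteq> x" for w
  proof -
    obtain s where s: "s \<in> S" "s w \<noteq> s x" using sep[OF wx] by blast
    then obtain c where "re (c * s w) \<noteq> re (c * s x)" using re_mult_unit_eqI by blast
    moreover have "R (\<lambda>z. c * s z) \<in> E"
      using lin_subspace_scale[OF lin s(1)] by (simp add: E_def)
    ultimately show ?thesis by (intro bexI[of _ "R (\<lambda>z. c * s z)"]) (simp_all add: R_def)
  qed
  show thesis
  proof (rule that[OF \<phi>x])
    fix f :: "'a \<Rightarrow> real" and \<epsilon> :: real assume f: "continuous_on UNIV f" and \<epsilon>: "\<epsilon> > 0"
    obtain g where g: "g \<in> E" "\<And>w. f w \<le> g w" "g x < f x + \<epsilon>"
      using extreme_minorant_sandwich[OF cpt UNIV_not_empty E q_ext oneE UNIV_I x sepE _ \<epsilon>, of f] f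
      by (auto simp: contf_def)
    then obtain s where "s \<in> S" "g = R s" by (auto simp: E_def)
    then show "\<exists>s\<in>S. (\<forall>v. f v \<le> re (s v)) \<and> re (s x) < f x + \<epsilon>"
      using g by (auto simp: R_def)
  qed
qed

text \<open>The norm of a scalar \<open>x\<close> is the maximum of \<open>re (c * x)\<close> over
  \<open>norm c = 1\<close>. On the product with the unit sphere the one-sided supremum of this real
  function is therefore the norm of \<open>g\<close>.\<close>

definition unit_graph :: "('b \<Rightarrow> 'k::rc_scalar) \<Rightarrow> 'b \<times> 'k \<Rightarrow> real" where
  "unit_graph g = (\<lambda>p. re (snd p * g (fst p)))"

lemma re_mult_of_real_mult: "re (c * (of_real r * x)) = r * re (c * x)"
  by (simp only: mult.left_commute[of c] re_of_real_mult)

lemma unit_graph_scale: "r *\<^sub>R unit_graph g = unit_graph (\<lambda>z. of_real r * g z)"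
  by (simp add: unit_graph_def fun_eq_iff re_mult_of_real_mult)

lemma unit_graph_add: "unit_graph f + unit_graph g = unit_graph (\<lambda>z. 1 * f z + 1 * g z)"
  by (simp add: unit_graph_def fun_eq_iff distrib_left inner_add_left)

lemma unit_graph_contf:
  assumes "g \<in> CC"
  shows "unit_graph g \<in> contf W"
proof -
  have "continuous_on W (\<lambda>p. g (fst p))"
    using assms unfolding CC_def
    by (intro continuous_on_compose2[of UNIV g W fst] continuous_intros) auto
  then show ?thesis
    unfolding unit_graph_def contf_def by (auto intro!: continuous_intros)
qed

lemma subspace_unit_graph:
  assumes "lin_subspace N"
  shows "subspace (unit_graph ` N)"
  unfolding subspace_def
proof (intro conjI ballI allI)
  have "(0 :: 'a \<times> 'b \<Rightarrow> real) = unit_graph (\<lambda>_. 0)"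
    by (simp add: unit_graph_def fun_eq_iff)
  then show "(0 :: 'a \<times> 'b \<Rightarrow> real) \<in> unit_graph ` N"
    using lin_subspace_zero[OF assms] by simp
  fix e assume "e \<in> unit_graph ` N"
  then obtain g where g: "g \<in> N" "e = unit_graph g" by auto
  show "r *\<^sub>R e \<in> unit_graph ` N" for r
  proof (rule image_eqI)
    show "r *\<^sub>R e = unit_graph (\<lambda>z. of_real r * g z)"
      unfolding g by (rule unit_graph_scale)
  qed (rule lin_subspace_scale[OF assms g(1)])
  fix e' assume "e' \<in> unit_graph ` N"
  then obtain g' where g': "g' \<in> N" "e' = unit_graph g'" by auto
  show "e + e' \<in> unit_graph ` N"
  proof (rule image_eqI)
    show "e + e' = unit_graph (\<lambda>z. 1 * g z + 1 * g' z)"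
      unfolding g g' by (rule unit_graph_add)
  qed (rule lin_subspace_lincomb[OF assms g(1) g'(1)])
qed

lemma inj_unit_graph: "inj unit_graph"
proof (rule injI, rule ext, rule re_mult_unit_eqI)
  fix g g' :: "'a \<Rightarrow> 'b" and y :: 'a and c :: 'b
  assume "unit_graph g = unit_graph g'"
  from fun_cong[OF this, of "(y, c)"] show "re (c * g y) = re (c * g' y)"
    by (simp add: unit_graph_def)
qed

lemma compact_unit_graph_domain:
  assumes "compact (UNIV :: 'b::t2_space set)"
  shows "compact ((UNIV :: 'b set) \<times> sphere (0 :: 'k::rc_scalar) 1)"
    "(UNIV :: 'b set) \<times> sphere (0 :: 'k) 1 \<noteq> {}"
proof -
  show "compact ((UNIV :: 'b set) \<times> sphere (0 :: 'k::rc_scalar) 1)"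
    using assms by (intro compact_Times compact_sphere)
  have "(1::'k) \<in> sphere 0 1" by simp
  then show "(UNIV :: 'b set) \<times> sphere (0 :: 'k) 1 \<noteq> {}" by blast
qed

text \<open>An element \<open>\<phi>\<close> of the dual ball gives the real minorant
  \<open>re (c * \<phi> g)\<close>, so a decomposition of evaluation at \<open>z\<close> becomes one
  of evaluation at \<open>(z, c)\<close>, which is extreme.\<close>

lemma extreme_pt_unit_graph_choquet:
  fixes N :: "('b::t2_space \<Rightarrow> 'k::rc_scalar) set"
  assumes cpt: "compact (UNIV :: 'b set)" and N: "lin_subspace N" "N \<subseteq> CC"
    and w: "extreme_pt (UNIV \<times> sphere 0 1) (unit_graph ` N) (z, c)"
  shows "z \<in> choquet N"
proof -
  define W where "W = (UNIV :: 'b set) \<times> sphere (0 :: 'k) 1"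
  note W = compact_unit_graph_domain[OF cpt, where 'k = 'k, folded W_def]
  have c: "norm c = 1" using w by (simp add: extreme_pt_def)
  have zW: "(z, c) \<in> W" using w by (simp add: extreme_pt_def W_def)
  have ext: "extreme_minorant (unit_graph ` N) (supw W) (\<lambda>f. f (z, c))"
    using w by (simp add: extreme_pt_def W_def)
  have supn_le: "supn g \<le> supw W (unit_graph g)" if g: "g \<in> N" for g
  proof (rule supn_least)
    fix y
    obtain d :: 'k where d: "norm d = 1" "d * g y = of_real (norm (g y))" by (rule unit_rotation)
    have "unit_graph g (y, d) \<le> supw W (unit_graph g)"
      by (rule le_supw[OF W unit_graph_contf[OF subsetD[OF N(2) g]]]) (use d in \<open>simp add: W_def\<close>)
    then show "norm (g y) \<le> supw W (unit_graph g)" by (simp add: unit_graph_def d(2))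
  qed
  define real_part where "real_part \<phi> G = re (c * \<phi> (inv_into N unit_graph G))"
    for \<phi> :: "('b \<Rightarrow> 'k) \<Rightarrow> 'k" and G
  have rp: "real_part \<phi> (unit_graph g) = re (c * \<phi> g)" if "g \<in> N" for \<phi> g
    using that inv_into_f_f[OF inj_on_subset[OF inj_unit_graph subset_UNIV, of N]]
    by (simp add: real_part_def)
  have min: "minorant (unit_graph ` N) (supw W) (real_part \<phi>)" if \<phi>: "\<phi> \<in> dual_ball N" for \<phi>
    unfolding minorant_def functional_on_def
  proof (intro conjI ballI allI)
    fix u v assume "u \<in> unit_graph ` N" "v \<in> unit_graph ` N"
    then obtain f g where fg: "f \<in> N" "u = unit_graph f" "g \<in> N" "v = unit_graph g" by auto
    have "u + v = unit_graph (\<lambda>z. 1 * f z + 1 * g z)"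
      unfolding fg by (rule unit_graph_add)
    then have "real_part \<phi> (u + v) = re (c * \<phi> (\<lambda>z. 1 * f z + 1 * g z))"
      by (simp only: rp[OF lin_subspace_lincomb[OF N(1) fg(1,3)]])
    then show "real_part \<phi> (u + v) = real_part \<phi> u + real_part \<phi> v"
      unfolding dual_ball_lincomb[OF \<phi> fg(1,3)] fg(2,4) rp[OF fg(1)] rp[OF fg(3)]
      by (simp add: distrib_left inner_add_left)
  next
    fix u and r :: real assume "u \<in> unit_graph ` N"
    then obtain f where f: "f \<in> N" "u = unit_graph f" by auto
    have "r *\<^sub>R u = unit_graph (\<lambda>z. of_real r * f z)"
      unfolding f by (rule unit_graph_scale)
    then have "real_part \<phi> (r *\<^sub>R u) = re (c * \<phi> (\<lambda>z. of_real r * f z))"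
      by (simp only: rp[OF lin_subspace_scale[OF N(1) f(1)]])
    then show "real_part \<phi> (r *\<^sub>R u) = r * real_part \<phi> u"
      unfolding dual_ball_scale[OF \<phi> f(1)] f(2) rp[OF f(1)] re_mult_of_real_mult .
  next
    fix u assume "u \<in> unit_graph ` N"
    then obtain f where f: "f \<in> N" "u = unit_graph f" by auto
    have "re (c * \<phi> f) \<le> norm (\<phi> f)"
      using re_le_norm[of "c * \<phi> f"] c by (simp add: norm_mult)
    also have "\<dots> \<le> supn f" by (rule dual_ball_norm[OF \<phi> f(1)])
    finally show "real_part \<phi> u \<le> supw W u"
      unfolding f(2) rp[OF f(1)] using supn_le[OF f(1)] by simp
  qed
  have "dual_extreme N (\<lambda>g. g z)"
    unfolding dual_extreme_def
  proof (intro conjI ballI allI impI)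
    show "(\<lambda>g. g z) \<in> dual_ball N"
      unfolding dual_ball_def using norm_le_supn[OF cpt] N(2) by auto
    fix \<phi>1 \<phi>2 :: "('b \<Rightarrow> 'k) \<Rightarrow> 'k" and t :: real and f
    assume \<phi>1: "\<phi>1 \<in> dual_ball N" and \<phi>2: "\<phi>2 \<in> dual_ball N"
      and H: "0 < t \<and> t < 1 \<and> (\<forall>f\<in>N. f z = of_real t * \<phi>1 f + of_real (1 - t) * \<phi>2 f)"
      and f: "f \<in> N"
    have t: "0 < t" "t < 1" using H by blast+
    have mean: "u (z, c) = t * real_part \<phi>1 u + (1 - t) * real_part \<phi>2 u"
      if "u \<in> unit_graph ` N" for u
    proof -
      obtain g where g: "g \<in> N" "u = unit_graph g" using \<open>u \<in> unit_graph ` N\<close> by auto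
      have "u (z, c) = re (c * (of_real t * \<phi>1 g + of_real (1 - t) * \<phi>2 g))"
        using H g by (simp add: unit_graph_def)
      also have "c * (of_real t * \<phi>1 g + of_real (1 - t) * \<phi>2 g)
          = of_real t * (c * \<phi>1 g) + of_real (1 - t) * (c * \<phi>2 g)"
        by (simp only: distrib_left mult.left_commute)
      also have "re \<dots> = t * re (c * \<phi>1 g) + (1 - t) * re (c * \<phi>2 g)"
        by (simp only: inner_add_left re_of_real_mult)
      finally show ?thesis unfolding g(2) rp[OF g(1)] .
    qed
    have eq: "\<forall>u\<in>unit_graph ` N. real_part \<phi>1 u = real_part \<phi>2 u"
      by (rule extreme_minorantD[OF ext min[OF \<phi>1] min[OF \<phi>2] t mean])
    \<comment> \<open>\<open>eq\<close> only compares real parts; testing it on all multiples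
      \<open>d * f\<close> recovers the scalars.\<close>
    have "c * \<phi>1 f = c * \<phi>2 f"
    proof (rule re_mult_unit_eqI)
      fix d :: 'k
      have df: "(\<lambda>z. d * f z) \<in> N" by (rule lin_subspace_scale[OF N(1) f])
      have "re (c * \<phi>1 (\<lambda>z. d * f z)) = re (c * \<phi>2 (\<lambda>z. d * f z))"
        using eq df rp[OF df] by fastforce
      then show "re (d * (c * \<phi>1 f)) = re (d * (c * \<phi>2 f))"
        unfolding dual_ball_scale[OF \<phi>1 f] dual_ball_scale[OF \<phi>2 f] by (simp add: mult.left_commute)
    qed
    then show "\<phi>1 f = \<phi>2 f" using c by auto
  qed
  then show ?thesis by (simp add: choquet_def kspan_lin_subspace[OF N(1)])
qed

section \<open>Convergence of positive operators\<close>

lemma nonneg_re: "0 \<le> (x :: 'k::rc_scalar) \<Longrightarrow> 0 \<le> re x"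
  using nonneg_iff[of x] by blast

lemma nonneg_eq_of_real: "0 \<le> (x :: 'k::rc_scalar) \<Longrightarrow> of_real (re x) = x"
  using nonneg_iff[of x] by metis

lemma nonneg_of_real: "0 \<le> r \<Longrightarrow> 0 \<le> (of_real r :: 'k::rc_scalar)"
  using nonneg_iff[of "of_real r :: 'k"] by simp

text \<open>On real functions \<open>\<psi>\<close> is real, being a difference of its values at two nonnegative functions;
  splitting \<open>g - f\<close> along \<open>1\<close> and \<open>j\<close> then shows that \<open>\<psi>\<close> commutes with real parts.\<close>
lemma positive_functional_mono:
  fixes M :: "('a \<Rightarrow> 'k::rc_scalar) set"
  assumes M: "lin_subspace M" and real_part: "\<And>f. f \<in> M \<Longrightarrow> (\<lambda>x. of_real (re (f x))) \<in> M"
    and one: "(\<lambda>_. 1) \<in> M" and bdd: "\<And>f. f \<in> M \<Longrightarrow> \<exists>K. \<forall>x. norm (f x) \<le> K"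
    and \<psi>: "\<And>f g a b. f \<in> M \<Longrightarrow> g \<in> M \<Longrightarrow> \<psi> (\<lambda>x. a * f x + b * g x) = a * \<psi> f + b * \<psi> g"
    and pos: "\<And>f. f \<in> M \<Longrightarrow> (\<And>x. 0 \<le> f x) \<Longrightarrow> 0 \<le> \<psi> f"
    and fg: "f \<in> M" "g \<in> M" "\<And>x. re (f x) \<le> re (g x)"
  shows "re (\<psi> f) \<le> re (\<psi> g)"
proof -
  define R where "R h = (\<lambda>x. of_real (re (h x)) :: 'k)" for h :: "'a \<Rightarrow> 'k"
  have R: "R h \<in> M" if "h \<in> M" for h unfolding R_def by (rule real_part[OF that])
  have real: "\<psi> (R h) = of_real (re (\<psi> (R h)))" if h: "h \<in> M" for h
  proof -
    obtain K where K: "\<And>x. norm (h x) \<le> K" using bdd[OF h] by blast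
    define K' where "K' = max K 0"
    have "0 \<le> \<psi> (\<lambda>x. 1 * R h x + of_real K' * 1)"
    proof (rule pos[OF lin_subspace_lincomb[OF M R[OF h] one]])
      fix x
      have "0 \<le> re (h x) + K'" using abs_re_le[of "h x"] K[of x] by (simp add: K'_def)
      then have "0 \<le> (of_real (re (h x) + K') :: 'k)" by (rule nonneg_of_real)
      then show "0 \<le> 1 * R h x + of_real K' * 1" by (simp add: R_def)
    qed
    then have "0 \<le> 1 * \<psi> (R h) + of_real K' * \<psi> (\<lambda>_. 1)"
      unfolding \<psi>[OF R[OF h] one] .
    then have sum: "0 \<le> \<psi> (R h) + of_real K' * \<psi> (\<lambda>_. 1)"
      unfolding mult_1_left .
    have "0 \<le> (of_real 1 :: 'k)" by (rule nonneg_of_real) simp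
    then have one_nonneg: "0 \<le> \<psi> (\<lambda>_. 1)" by (intro pos[OF one]) simp
    have "\<psi> (R h) = (\<psi> (R h) + of_real K' * \<psi> (\<lambda>_. 1)) - of_real K' * \<psi> (\<lambda>_. 1)" by simp
    also have "\<dots> = of_real (re (\<psi> (R h) + of_real K' * \<psi> (\<lambda>_. 1)) - K' * re (\<psi> (\<lambda>_. 1)))"
      unfolding of_real_diff of_real_mult nonneg_eq_of_real[OF sum] nonneg_eq_of_real[OF one_nonneg] ..
    also have "\<dots> = of_real (re (\<psi> (R h)))" by (simp add: inner_add_left)
    finally show ?thesis .
  qed
  obtain j :: 'k where j: "re j = 0" "\<And>x::'k. x = of_real (re x) + of_real (re (- j * x)) * j"
    using imaginary_unit by blast
  define h where "h = (\<lambda>x. g x - f x)"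
  have h: "h \<in> M" unfolding h_def by (rule lin_subspace_diff[OF M fg(2,1)])
  define h' where "h' = (\<lambda>x. - j * h x)"
  have h': "h' \<in> M" unfolding h'_def by (rule lin_subspace_scale[OF M h])
  have "h = (\<lambda>x. 1 * R h x + j * R h' x)"
  proof
    fix x show "h x = 1 * R h x + j * R h' x"
      unfolding R_def h'_def using j(2)[of "h x"] by (simp only: mult_1_left mult.commute[of j])
  qed
  then have "\<psi> h = 1 * \<psi> (R h) + j * \<psi> (R h')"
    using \<psi>[OF R[OF h] R[OF h'], of 1 j] by simp
  also have "\<dots> = \<psi> (R h) + of_real (re (\<psi> (R h'))) * j"
    using real[OF h'] by (simp add: mult.commute)
  finally have "re (\<psi> h) = re (\<psi> (R h))"
    by (simp only: inner_add_left re_of_real_mult j(1) mult_zero_right add_0_right)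
  moreover have "0 \<le> \<psi> (R h)"
    unfolding R_def
    by (rule pos[OF real_part[OF h]], rule nonneg_of_real) (use fg(3) in \<open>simp add: h_def inner_diff_left\<close>)
  moreover have "\<psi> h = \<psi> g - \<psi> f"
    using \<psi>[OF fg(2,1), of 1 "-1"] by (simp add: h_def)
  ultimately show ?thesis using nonneg_re[of "\<psi> (R h)"] by (simp add: inner_diff_left)
qed

text \<open>For \<open>0 < \<rho> < 1\<close> the functional would be a proper mean of
  \<open>\<phi> / \<rho>\<close> and 0. For \<open>\<rho> = 0\<close> it would vanish and be the
  midpoint of plus and minus an evaluation, here at the arbitrary point
  \<open>undefined\<close>.\<close>

lemma dual_extreme_norm_one:
  fixes S :: "('a::topological_space \<Rightarrow> 'k::rc_scalar) set"
  assumes cpt: "compact (UNIV :: 'a set)" and S: "S \<subseteq> CC" "(\<lambda>_. 1) \<in> S"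
    and ext: "dual_extreme S \<phi>"
    and \<rho>: "0 \<le> \<rho>" "\<phi> (\<lambda>_. 1) = of_real \<rho>" "\<And>s. s \<in> S \<Longrightarrow> norm (\<phi> s) \<le> \<rho> * supn s"
  shows "\<rho> = 1"
proof (rule ccontr)
  assume "\<rho> \<noteq> 1"
  have \<phi>: "\<phi> \<in> dual_ball S" using ext by (simp add: dual_extreme_def)
  have supn1: "supn (\<lambda>_::'a. 1 :: 'k) \<le> 1" by (rule supn_least) simp
  have supn0: "0 \<le> supn s" if "s \<in> S" for s
    using norm_le_supn[OF cpt subsetD[OF S(1) that]] norm_ge_zero order.trans by blast
  have "norm (\<phi> (\<lambda>_. 1)) \<le> 1" using dual_ball_norm[OF \<phi> S(2)] supn1 by linarith
  then have "\<rho> < 1" using \<rho>(1) \<open>\<rho> \<noteq> 1\<close> unfolding \<rho>(2) by simp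
  show False
  proof (cases "\<rho> = 0")
    case True
    have zero: "\<phi> s = 0" if "s \<in> S" for s using \<rho>(3)[OF that] True by simp
    have "(1 :: 'k) = - 1"
    proof (rule dual_extremeD[OF ext, of "\<lambda>g. g undefined" "\<lambda>g. - g undefined" "1/2" "\<lambda>_. 1"])
      show "(\<lambda>g. g undefined) \<in> dual_ball S" "(\<lambda>g. - g undefined) \<in> dual_ball S"
        unfolding dual_ball_def using norm_le_supn[OF cpt subsetD[OF S(1)]] by auto
    qed (use zero S(2) in auto)
    from arg_cong[OF this, of re] show False by simp
  next
    case False
    then have "\<rho> > 0" using \<rho>(1) by simp
    have "\<phi> (\<lambda>_. 1) / of_real \<rho> = 0"
    proof (rule dual_extremeD[OF ext, of "\<lambda>g. \<phi> g / of_real \<rho>" "\<lambda>g. 0" \<rho> "\<lambda>_. 1"])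
      show "(\<lambda>g. \<phi> g / of_real \<rho>) \<in> dual_ball S"
        unfolding dual_ball_def
      proof (intro CollectI conjI ballI allI)
        fix f g a b assume fg: "f \<in> S" "g \<in> S"
        show "\<phi> (\<lambda>z. a * f z + b * g z) / of_real \<rho> = a * (\<phi> f / of_real \<rho>) + b * (\<phi> g / of_real \<rho>)"
          unfolding dual_ball_lincomb[OF \<phi> fg] by (simp add: add_divide_distrib)
      next
        fix f assume "f \<in> S"
        from \<rho>(3)[OF this] show "norm (\<phi> f / of_real \<rho>) \<le> supn f"
          using \<open>\<rho> > 0\<close> by (simp add: norm_divide field_simps)
      qed
      show "(\<lambda>g. 0) \<in> dual_ball S"
        unfolding dual_ball_def using supn0 by simp
    qed (use \<open>\<rho> > 0\<close> \<open>\<rho> < 1\<close> S(2) in auto)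
    then show False using \<open>\<rho> > 0\<close> \<rho>(2) by simp
  qed
qed

lemma dual_extreme_comp_isometry:
  assumes S: "lin_subspace S"
    and lin: "\<And>f g a b. f \<in> S \<Longrightarrow> g \<in> S \<Longrightarrow> T (\<lambda>x. a * f x + b * g x) = (\<lambda>y. a * T f y + b * T g y)"
    and norm: "\<And>s. s \<in> S \<Longrightarrow> supn (T s) = supn s" and inj: "inj_on T S"
    and ext: "dual_extreme (T ` S) \<psi>"
  shows "dual_extreme S (\<lambda>s. \<psi> (T s))"
  unfolding dual_extreme_def
proof (intro conjI ballI allI impI)
  have \<psi>: "\<psi> \<in> dual_ball (T ` S)" using ext by (simp add: dual_extreme_def)
  show "(\<lambda>s. \<psi> (T s)) \<in> dual_ball S"
    unfolding dual_ball_def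
  proof (intro CollectI conjI ballI allI)
    fix f g a b assume fg: "f \<in> S" "g \<in> S"
    show "\<psi> (T (\<lambda>z. a * f z + b * g z)) = a * \<psi> (T f) + b * \<psi> (T g)"
      unfolding lin[OF fg] by (rule dual_ball_lincomb[OF \<psi> imageI[OF fg(1)] imageI[OF fg(2)]])
  next
    fix f assume f: "f \<in> S"
    show "norm (\<psi> (T f)) \<le> supn f"
      using dual_ball_norm[OF \<psi> imageI[OF f]] norm[OF f] by simp
  qed
  have transport: "(\<lambda>g. \<phi> (inv_into S T g)) \<in> dual_ball (T ` S)" if \<phi>: "\<phi> \<in> dual_ball S" for \<phi>
    unfolding dual_ball_def
  proof (intro CollectI conjI ballI allI)
    fix f g a b assume "f \<in> T ` S" "g \<in> T ` S"
    then obtain u v where uv: "u \<in> S" "f = T u" "v \<in> S" "g = T v" by blast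
    have "\<phi> (inv_into S T (T (\<lambda>z. a * u z + b * v z))) = a * \<phi> u + b * \<phi> v"
      unfolding inv_into_f_f[OF inj lin_subspace_lincomb[OF S uv(1,3)]]
      by (rule dual_ball_lincomb[OF \<phi> uv(1,3)])
    then show "\<phi> (inv_into S T (\<lambda>z. a * f z + b * g z)) = a * \<phi> (inv_into S T f) + b * \<phi> (inv_into S T g)"
      unfolding lin[OF uv(1,3)] uv(2,4) inv_into_f_f[OF inj uv(1)] inv_into_f_f[OF inj uv(3)] .
  next
    fix f assume "f \<in> T ` S"
    then obtain u where u: "u \<in> S" "f = T u" by blast
    show "norm (\<phi> (inv_into S T f)) \<le> supn f"
      unfolding u(2) inv_into_f_f[OF inj u(1)] norm[OF u(1)] by (rule dual_ball_norm[OF \<phi> u(1)])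
  qed
  fix \<phi>1 \<phi>2 and t :: real and s
  assume \<phi>1: "\<phi>1 \<in> dual_ball S" and \<phi>2: "\<phi>2 \<in> dual_ball S" and s: "s \<in> S"
    and H: "0 < t \<and> t < 1 \<and> (\<forall>f\<in>S. \<psi> (T f) = of_real t * \<phi>1 f + of_real (1 - t) * \<phi>2 f)"
  have "\<phi>1 (inv_into S T (T s)) = \<phi>2 (inv_into S T (T s))"
  proof (rule dual_extremeD[OF ext transport[OF \<phi>1] transport[OF \<phi>2]])
    show "0 < t" "t < 1" using H by blast+
    show "T s \<in> T ` S" using s by blast
    fix f assume "f \<in> T ` S"
    then obtain u where u: "u \<in> S" "f = T u" by blast
    show "\<psi> f = of_real t * \<phi>1 (inv_into S T f) + of_real (1 - t) * \<phi>2 (inv_into S T f)"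
      unfolding u(2) inv_into_f_f[OF inj u(1)] using H u(1) by blast
  qed
  then show "\<phi>1 s = \<phi>2 s" unfolding inv_into_f_f[OF inj s] .
qed

text \<open>When \<open>re z\<close> is at most 0, expanding the square leaves no positive cross
  term. The excess of the norm over the shift \<open>r\<close> is thus of order
  \<open>1 / r\<close>, which vanishes for large shifts.\<close>

lemma norm_add_real_le:
  fixes z :: "'k::rc_scalar"
  assumes "re z \<le> 0" "norm z \<le> B" "0 < r"
  shows "norm (z + of_real r) \<le> r + B\<^sup>2 / (2 * r)"
proof (rule power2_le_imp_le)
  have B: "(norm z)\<^sup>2 \<le> B\<^sup>2" using assms(2) by (intro power_mono) auto
  have "(norm (z + of_real r))\<^sup>2 = (norm z)\<^sup>2 + 2 * (z \<bullet> of_real r) + r\<^sup>2"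
  proof -
    have "(norm (z + of_real r))\<^sup>2 = z \<bullet> z + z \<bullet> of_real r + (z \<bullet> of_real r + (of_real r :: 'k) \<bullet> of_real r)"
      unfolding power2_norm_eq_inner inner_add_left inner_add_right inner_commute[of "of_real r" z]
      by (rule refl)
    also have "\<dots> = (norm z)\<^sup>2 + 2 * (z \<bullet> of_real r) + (norm (of_real r :: 'k))\<^sup>2"
      unfolding power2_norm_eq_inner by linarith
    finally show ?thesis by simp
  qed
  also have "z \<bullet> of_real r = r * re z" by (simp add: of_real_def)
  also have "(norm z)\<^sup>2 + 2 * (r * re z) + r\<^sup>2 \<le> B\<^sup>2 + r\<^sup>2"
    using B mult_nonneg_nonpos[of r "re z"] assms(1,3) by linarith
  also have "\<dots> \<le> (r + B\<^sup>2 / (2 * r))\<^sup>2"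
    using assms(3) by (simp add: power2_sum)
  finally show "(norm (z + of_real r))\<^sup>2 \<le> (r + B\<^sup>2 / (2 * r))\<^sup>2" .
  show "0 \<le> r + B\<^sup>2 / (2 * r)" using assms(3) by simp
qed

text \<open>Comparing \<open>c f\<close> with \<open>s - r\<close>, where \<open>s\<close> dominates it in real part and \<open>r\<close> is large, turns the
  norm bound into the upper bound \<open>Re (c w) \<le> Re (s x)\<close>. The isometry is thus compared only with its
  values on \<open>S\<close>, which makes the Mazur-Ulam theorem unnecessary.\<close>
lemma contraction_eval_unique:
  fixes S M :: "('a::t2_space \<Rightarrow> 'k::rc_scalar) set"
  assumes cpt: "compact (UNIV :: 'a set)" and S: "lin_subspace S" "(\<lambda>_. 1) \<in> S" "S \<subseteq> CC"
    and f: "f \<in> CC"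
    and sandwich: "\<And>u \<epsilon>. continuous_on UNIV u \<Longrightarrow> \<epsilon> > 0 \<Longrightarrow>
      \<exists>s\<in>S. (\<forall>v. u v \<le> re (s v)) \<and> re (s x) < u x + \<epsilon>"
    and contr: "\<And>s. s \<in> S \<Longrightarrow> norm (w - s x) \<le> supn (\<lambda>v. f v - s v)"
  shows "w = f x"
proof (rule re_mult_unit_eqI)
  fix c :: 'k assume c: "norm c = 1"
  have upper: "re (c * w) \<le> re (c * f x)" if c: "norm c = 1" for c
  proof (rule field_le_epsilon)
    fix e :: real assume e: "e > 0"
    have "continuous_on UNIV (\<lambda>v. re (c * f v))"
      using f unfolding CC_def by (auto intro!: continuous_intros)
    from sandwich[OF this, of "e/2"] e
    obtain s where s: "s \<in> S" "\<And>v. re (c * f v) \<le> re (s v)" "re (s x) < re (c * f x) + e/2"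
      by auto
    have csC: "(\<lambda>v. c * f v - s v) \<in> CC"
      by (rule lin_subspace_diff[OF lin_subspace_CC lin_subspace_scale[OF lin_subspace_CC f] subsetD[OF S(3) s(1)]])
    define B where "B = supn (\<lambda>v. c * f v - s v)"
    have B: "norm (c * f v - s v) \<le> B" for v
      unfolding B_def by (rule norm_le_supn[OF cpt csC])
    \<comment> \<open>Large enough for the excess in \<open>norm_add_real_le\<close> to be at most
      \<open>e / 2\<close>, and positive even when \<open>B = 0\<close>.\<close>
    define r where "r = B\<^sup>2 / e + 1"
    have r: "r > 0" using e by (simp add: r_def add_nonneg_pos)
    have Br: "B\<^sup>2 / (2 * r) \<le> e / 2"
    proof -
      have "B\<^sup>2 \<le> e * r" using e by (simp add: r_def field_simps)
      then show ?thesis using r by (simp add: field_simps)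
    qed
    \<comment> \<open>Rotated back, so that \<open>c * s' = s - r\<close>.\<close>
    define s' where "s' = (\<lambda>v. inverse c * s v + (- inverse c * of_real r) * 1)"
    have s': "s' \<in> S" unfolding s'_def by (rule lin_subspace_lincomb[OF S(1) s(1) S(2)])
    have c0: "c \<noteq> 0" using c by auto
    have cs': "c * s' v = s v - of_real r" for v
      using c0 by (simp add: s'_def right_diff_distrib mult.assoc[symmetric])
    have "re (c * w) - (re (s x) - r) = re (c * (w - s' x))"
      by (simp add: right_diff_distrib cs' inner_diff_left)
    also have "\<dots> \<le> norm (w - s' x)"
      using re_le_norm[of "c * (w - s' x)"] c by (simp add: norm_mult)
    also have "\<dots> \<le> supn (\<lambda>v. f v - s' v)" by (rule contr[OF s'])
    also have "\<dots> \<le> r + B\<^sup>2 / (2 * r)"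
    proof (rule supn_least)
      fix v
      have "norm (f v - s' v) = norm (c * (f v - s' v))" using c by (simp add: norm_mult)
      also have "c * (f v - s' v) = (c * f v - s v) + of_real r"
        by (simp add: right_diff_distrib cs')
      also have "norm \<dots> \<le> r + B\<^sup>2 / (2 * r)"
        by (rule norm_add_real_le[OF _ B r]) (use s(2)[of v] in \<open>simp add: inner_diff_left\<close>)
      finally show "norm (f v - s' v) \<le> r + B\<^sup>2 / (2 * r)" .
    qed
    finally show "re (c * w) \<le> re (c * f x) + e" using Br s(3) by linarith
  qed
  have "re (c * w) \<le> re (c * f x)" by (rule upper[OF c])
  moreover have "re (- c * w) \<le> re (- c * f x)" by (rule upper) (use c in simp)
  ultimately show "re (c * w) = re (c * f x)" by simp
qed

text \<open>Self-conjugacy enters as closure under real parts, which is automatic over the reals, so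
  both scalar fields are instances.\<close>

theorem positive_operators_tendsto:
  fixes M S :: "('a::t2_space \<Rightarrow> 'k::rc_scalar) set"
    and T :: "nat \<Rightarrow> ('a \<Rightarrow> 'k) \<Rightarrow> ('b::t2_space \<Rightarrow> 'k)"
  assumes cX: "compact (UNIV :: 'a set)" and cY: "compact (UNIV :: 'b set)"
    and M: "lin_subspace M" "M \<subseteq> CC" and real_part: "\<And>f. f \<in> M \<Longrightarrow> (\<lambda>x. of_real (re (f x))) \<in> M"
    and S: "function_space S" "S \<subseteq> M"
    and T: "\<And>n. T n ` M \<subseteq> CC" "\<And>n. linear_on M (T n)" "\<And>n. positive_on M (T n)"
    and Tinf: "Tinf ` M \<subseteq> CC" "isometry_on M Tinf"
    and lim: "\<And>f y. f \<in> S \<Longrightarrow> (\<lambda>n. T n f y) \<longlonglongrightarrow> Tinf f y"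
    and choquet: "choquet (kspan ((\<Union>n. T n ` M) \<union> Tinf ` M)) \<subseteq> choquet (Tinf ` S)"
    and bound: "\<And>n. supn (T n (\<lambda>_. 1)) \<le> B"
    and f: "f \<in> M"
  shows "(\<lambda>n. T n f y) \<longlonglongrightarrow> Tinf f y"
proof -
  have linS: "lin_subspace S" and SC: "S \<subseteq> CC" and oneS: "(\<lambda>_. 1) \<in> S"
    using S(1) by (auto simp: function_space_def)
  have oneM: "(\<lambda>_. 1) \<in> M" using oneS S(2) by blast
  have bdd: "\<exists>K. \<forall>x. norm (g x) \<le> K" if "g \<in> M" for g
    using norm_le_supn[OF cX subsetD[OF M(2) that]] by blast
  have Tlin: "T n (\<lambda>x. a * g x + b * h x) y = a * T n g y + b * T n h y"
    if "g \<in> M" "h \<in> M" for n g h a b y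
    using T(2)[of n] that unfolding linear_on_def by metis
  have Tpos: "0 \<le> T n g y" if "g \<in> M" "\<And>x. 0 \<le> g x" for n g y
    using T(3)[of n] that unfolding positive_on_def by blast
  have mono: "re (T n g y) \<le> re (T n h y)" if "g \<in> M" "h \<in> M" "\<And>x. re (g x) \<le> re (h x)" for n g h y
    by (rule positive_functional_mono[OF M(1) real_part oneM bdd, of "\<lambda>g. T n g y"])
      (use Tlin Tpos that in auto)
  have Tscale: "T n (\<lambda>x. c * g x) y = c * T n g y" if "g \<in> M" for n g c y
    using Tlin[OF that that, of n c 0] by simp
  have T1: "0 \<le> re (T n (\<lambda>_. 1) y)" "of_real (re (T n (\<lambda>_. 1) y)) = T n (\<lambda>_. 1) y" for n y
  proof -
    have "0 \<le> (of_real 1 :: 'k)" by (rule nonneg_of_real) simp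
    then have "0 \<le> T n (\<lambda>_. 1) y" by (intro Tpos[OF oneM]) simp
    from nonneg_re[OF this] nonneg_eq_of_real[OF this]
    show "0 \<le> re (T n (\<lambda>_. 1) y)" "of_real (re (T n (\<lambda>_. 1) y)) = T n (\<lambda>_. 1) y" .
  qed
  \<comment> \<open>Rotating \<open>g\<close> makes \<open>T n g y\<close> real and nonnegative;
    positivity then compares it with the constant \<open>supn g\<close>.\<close>
  have Tnorm: "norm (T n g y) \<le> re (T n (\<lambda>_. 1) y) * supn g" if g: "g \<in> M" for n g y
  proof -
    obtain c :: 'k where c: "norm c = 1" "c * T n g y = of_real (norm (T n g y))"
      by (rule unit_rotation)
    have "norm (T n g y) = re (T n (\<lambda>x. c * g x) y)" by (simp add: Tscale[OF g] c(2))
    also have "\<dots> \<le> re (T n (\<lambda>x. of_real (supn g) * 1) y)"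
    proof (rule mono[OF lin_subspace_scale[OF M(1) g] lin_subspace_scale[OF M(1) oneM]])
      fix x
      have "re (c * g x) \<le> norm (g x)" using re_le_norm[of "c * g x"] c(1) by (simp add: norm_mult)
      also have "\<dots> \<le> supn g" by (rule norm_le_supn[OF cX subsetD[OF M(2) g]])
      finally show "re (c * g x) \<le> re (of_real (supn g) * 1)" by simp
    qed
    also have "\<dots> = supn g * re (T n (\<lambda>_. 1) y)"
      unfolding Tscale[OF oneM] by (rule re_of_real_mult)
    finally show ?thesis by (simp add: mult.commute)
  qed
  have T1B: "re (T n (\<lambda>_. 1) y) \<le> B" for n y
  proof -
    have "T n (\<lambda>_. 1) \<in> CC" using T(1) oneM by blast
    from norm_le_supn[OF cY this, of y] show ?thesis
      using bound[of n] re_le_norm[of "T n (\<lambda>_. 1) y"] by linarith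
  qed
  \<comment> \<open>Linearity on \<open>S\<close> comes from the limit. It gives
    \<open>Tinf 0 = 0\<close>, so the isometry preserves norms on \<open>S\<close>.\<close>
  have Tinf_lin: "Tinf (\<lambda>x. a * g x + b * h x) = (\<lambda>y. a * Tinf g y + b * Tinf h y)"
    if gh: "g \<in> S" "h \<in> S" for g h a b
  proof
    fix y
    have gM: "g \<in> M" "h \<in> M" using gh S(2) by auto
    have "(\<lambda>n. T n (\<lambda>x. a * g x + b * h x) y) \<longlonglongrightarrow> Tinf (\<lambda>x. a * g x + b * h x) y"
      by (rule lim[OF lin_subspace_lincomb[OF linS gh]])
    moreover have "(\<lambda>n. T n (\<lambda>x. a * g x + b * h x) y) \<longlonglongrightarrow> a * Tinf g y + b * Tinf h y"
      unfolding Tlin[OF gM] using lim[OF gh(1)] lim[OF gh(2)] by (intro tendsto_intros)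
    ultimately show "Tinf (\<lambda>x. a * g x + b * h x) y = a * Tinf g y + b * Tinf h y"
      by (rule LIMSEQ_unique)
  qed
  have iso: "supn (\<lambda>y. Tinf g y - Tinf h y) = supn (\<lambda>x. g x - h x)" if "g \<in> M" "h \<in> M" for g h
    using Tinf(2) that unfolding isometry_on_def by blast
  have Tinf0: "Tinf (\<lambda>_. 0) = (\<lambda>_. 0)"
    using Tinf_lin[OF oneS oneS, of 0 0] by simp
  have zeroS: "(\<lambda>_. 0) \<in> S" by (rule lin_subspace_zero[OF linS])
  have isoS: "supn (Tinf s) = supn s" if "s \<in> S" for s
    using iso[of s "\<lambda>_. 0"] that S(2) zeroS by (auto simp: Tinf0)
  have injS: "inj_on Tinf S"
  proof (rule inj_onI, rule ext)
    fix s s' x assume ss: "s \<in> S" "s' \<in> S" "Tinf s = Tinf s'"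
    have sM: "s \<in> M" "s' \<in> M" using ss S(2) by auto
    have "norm (s x - s' x) \<le> supn (\<lambda>x. s x - s' x)"
      using norm_le_supn[OF cX subsetD[OF M(2) lin_subspace_diff[OF M(1) sM]]] .
    also have "\<dots> = supn (\<lambda>y. Tinf s y - Tinf s' y)" using iso[OF sM] by simp
    also have "\<dots> = 0" by (simp add: ss(3) supn_def)
    finally show "s x = s' x" by simp
  qed
  have linTS: "lin_subspace (Tinf ` S)"
    unfolding lin_subspace_def
  proof (intro conjI ballI allI)
    show "(\<lambda>_. 0) \<in> Tinf ` S" using zeroS Tinf0 by (metis imageI)
    fix g assume "g \<in> Tinf ` S"
    then obtain s where s: "s \<in> S" "g = Tinf s" by blast
    show "(\<lambda>z. a * g z) \<in> Tinf ` S" for a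
      using Tinf_lin[OF s(1) s(1), of a 0] imageI[OF lin_subspace_scale[OF linS s(1)], of Tinf a] s(2)
      by simp
    fix h assume "h \<in> Tinf ` S"
    then obtain s' where s': "s' \<in> S" "h = Tinf s'" by blast
    show "(\<lambda>z. g z + h z) \<in> Tinf ` S"
      using Tinf_lin[OF s(1) s'(1), of 1 1] imageI[OF lin_subspace_lincomb[OF linS s(1) s'(1)], of Tinf 1 1] s(2) s'(2)
      by simp
  qed
  define N where "N = kspan ((\<Union>n. T n ` M) \<union> Tinf ` M)"
  have N: "lin_subspace N" "N \<subseteq> CC"
  proof -
    show "lin_subspace N" unfolding N_def by (rule lin_subspace_kspan)
    show "N \<subseteq> CC" unfolding N_def
      by (rule kspan_minimal[OF lin_subspace_CC]) (use T(1) Tinf(1) in blast)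
  qed
  have on_boundary: "(\<lambda>n. T n g z) \<longlonglongrightarrow> Tinf g z" if z: "z \<in> choquet N" and g: "g \<in> M" for z g
  proof -
    have "dual_extreme (Tinf ` S) (\<lambda>g. g z)"
      using z choquet kspan_lin_subspace[OF linTS] unfolding N_def choquet_def by auto
    then have ext: "dual_extreme S (\<lambda>s. Tinf s z)"
      by (rule dual_extreme_comp_isometry[where T = Tinf and \<psi> = "\<lambda>g. g z", OF linS _ _ injS, rotated 2])
        (rule Tinf_lin isoS; assumption)+
    have lim1: "(\<lambda>n. re (T n (\<lambda>_. 1) z)) \<longlonglongrightarrow> re (Tinf (\<lambda>_. 1) z)"
      by (rule tendsto_inner[OF lim[OF oneS] tendsto_const])
    \<comment> \<open>The limit of \<open>T n 1 z\<close>. Passing to the limit in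
      \<open>Tnorm\<close> bounds \<open>Tinf s z\<close> by \<open>\<rho> * supn s\<close>, and
      extremality then forces \<open>\<rho> = 1\<close>.\<close>
    define \<rho> where "\<rho> = re (Tinf (\<lambda>_. 1) z)"
    have \<rho>0: "0 \<le> \<rho>"
      unfolding \<rho>_def by (rule LIMSEQ_le_const[OF lim1]) (use T1(1) in auto)
    have "(\<lambda>n. of_real (re (T n (\<lambda>_. 1) z)) :: 'k) \<longlonglongrightarrow> of_real \<rho>"
      unfolding \<rho>_def by (rule tendsto_of_real[OF lim1])
    then have \<rho>1: "Tinf (\<lambda>_. 1) z = of_real \<rho>"
      using lim[OF oneS, of z] LIMSEQ_unique unfolding T1(2) by blast
    have norm\<rho>: "norm (Tinf s z) \<le> \<rho> * supn s" if s: "s \<in> S" for s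
    proof (rule LIMSEQ_le)
      show "(\<lambda>n. norm (T n s z)) \<longlonglongrightarrow> norm (Tinf s z)" by (rule tendsto_norm[OF lim[OF s]])
      show "(\<lambda>n. re (T n (\<lambda>_. 1) z) * supn s) \<longlonglongrightarrow> \<rho> * supn s"
        unfolding \<rho>_def by (rule tendsto_mult_right[OF lim1])
      show "\<exists>N. \<forall>n\<ge>N. norm (T n s z) \<le> re (T n (\<lambda>_. 1) z) * supn s"
        using Tnorm[OF subsetD[OF S(2) s]] by blast
    qed
    have "\<rho> = 1"
      by (rule dual_extreme_norm_one[OF cX SC oneS ext \<rho>0 \<rho>1 norm\<rho>])
    \<comment> \<open>With \<open>\<rho> = 1\<close> the real part is dominated by the one-sided
      supremum, as \<open>dual_extreme_eval_sandwich\<close> requires.\<close>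
    have le: "re (Tinf s z) \<le> c" if s: "s \<in> S" "\<And>x. re (s x) \<le> c" for s c
    proof -
      have "re (T n s z) \<le> c * re (T n (\<lambda>_. 1) z)" for n
      proof -
        have "re (T n s z) \<le> re (T n (\<lambda>x. of_real c * 1) z)"
          by (rule mono[OF subsetD[OF S(2) s(1)] lin_subspace_scale[OF M(1) oneM]]) (use s(2) in simp)
        also have "\<dots> = c * re (T n (\<lambda>_. 1) z)"
          unfolding Tscale[OF oneM] by (rule re_of_real_mult)
        finally show ?thesis .
      qed
      moreover have "(\<lambda>n. re (T n s z)) \<longlonglongrightarrow> re (Tinf s z)"
        by (rule tendsto_inner[OF lim[OF s(1)] tendsto_const])
      moreover have "(\<lambda>n. c * re (T n (\<lambda>_. 1) z)) \<longlonglongrightarrow> c * \<rho>"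
        unfolding \<rho>_def by (rule tendsto_mult_left[OF lim1])
      ultimately have "re (Tinf s z) \<le> c * \<rho>" by (intro LIMSEQ_le) auto
      then show ?thesis using \<open>\<rho> = 1\<close> by simp
    qed
    obtain x where x: "\<And>s. s \<in> S \<Longrightarrow> Tinf s z = s x"
      "\<And>u \<epsilon>. continuous_on UNIV u \<Longrightarrow> \<epsilon> > 0 \<Longrightarrow>
        \<exists>s\<in>S. (\<forall>v. u v \<le> re (s v)) \<and> re (s x) < u x + \<epsilon>"
      using dual_extreme_eval_sandwich[OF cX S(1) ext le] by blast
    have Tinf_x: "Tinf g z = g x"
    proof (rule contraction_eval_unique[OF cX linS oneS SC subsetD[OF M(2) g] x(2)])
      fix s assume s: "s \<in> S"
      have sM: "s \<in> M" using s S(2) by blast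
      have "(\<lambda>y. Tinf g y - Tinf s y) \<in> CC"
        by (rule lin_subspace_diff[OF lin_subspace_CC]) (use Tinf(1) g sM in blast)+
      from norm_le_supn[OF cY this, of z]
      show "norm (Tinf g z - s x) \<le> supn (\<lambda>v. g v - s v)"
        unfolding iso[OF g sM] x(1)[OF s] .
    qed
    \<comment> \<open>Only an upper bound is needed: applied to \<open>c * g\<close> and
      \<open>- c * g\<close> it squeezes the real part from both sides.\<close>
    have upper: "\<forall>\<^sub>F n in sequentially. re (T n h z) < re (h x) + e" if h: "h \<in> M" and e: "e > 0" for h e
    proof -
      obtain s where s: "s \<in> S" "\<And>v. re (h v) \<le> re (s v)" "re (s x) < re (h x) + e"
        using x(2)[OF continuous_on_re[OF subsetD[OF M(2) h]] e] by blast
      have "(\<lambda>n. re (T n s z)) \<longlonglongrightarrow> re (s x)"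
        using tendsto_inner[OF lim[OF s(1), of z] tendsto_const, of 1] unfolding x(1)[OF s(1)] .
      then have "\<forall>\<^sub>F n in sequentially. re (T n s z) < re (h x) + e"
        by (rule order_tendstoD(2)[OF _ s(3)])
      then show ?thesis
      proof (rule eventually_mono)
        fix n assume "re (T n s z) < re (h x) + e"
        then show "re (T n h z) < re (h x) + e"
          using mono[OF h subsetD[OF S(2) s(1)] s(2), of n z] by linarith
      qed
    qed
    have "(\<lambda>n. T n g z) \<longlonglongrightarrow> g x"
    proof (rule tendsto_re_mult_unitI)
      fix c :: 'k
      have cg: "(\<lambda>v. c * g v) \<in> M" "(\<lambda>v. - c * g v) \<in> M" by (rule lin_subspace_scale[OF M(1) g])+
      show "(\<lambda>n. re (c * T n g z)) \<longlonglongrightarrow> re (c * g x)"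
      proof (rule order_tendstoI)
        fix a assume "a < re (c * g x)"
        then have "\<forall>\<^sub>F n in sequentially. re (T n (\<lambda>v. - c * g v) z) < re (- c * g x) + (re (c * g x) - a)"
          by (intro upper[OF cg(2)]) simp
        then show "\<forall>\<^sub>F n in sequentially. a < re (c * T n g z)"
          by (rule eventually_mono) (unfold Tscale[OF g], simp)
      next
        fix a assume "re (c * g x) < a"
        then have "\<forall>\<^sub>F n in sequentially. re (T n (\<lambda>v. c * g v) z) < re (c * g x) + (a - re (c * g x))"
          by (intro upper[OF cg(1)]) simp
        then show "\<forall>\<^sub>F n in sequentially. re (c * T n g z) < a"
          by (rule eventually_mono) (unfold Tscale[OF g], simp)
      qed
    qed
    then show ?thesis unfolding Tinf_x .
  qed
  define W where "W = (UNIV :: 'b set) \<times> sphere (0 :: 'k) 1"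
  note W = compact_unit_graph_domain[OF cY, where 'k = 'k, folded W_def]
  define F where "F n = unit_graph (\<lambda>y. T n f y - Tinf f y)" for n
  have dN: "(\<lambda>y. T n f y - Tinf f y) \<in> N" for n
  proof (rule lin_subspace_diff[OF N(1)])
    show "T n f \<in> N" "Tinf f \<in> N" unfolding N_def by (rule subsetD[OF kspan_superset], use f in blast)+
  qed
  have Finf: "Tinf f \<in> CC" using Tinf(1) f by blast
  show ?thesis
  proof (rule LIM_zero_cancel, rule tendsto_re_mult_unitI)
    fix c :: 'k assume c: "norm c = 1"
    have "(\<lambda>n. F n (y, c)) \<longlonglongrightarrow> 0"
    proof (rule tendsto_zero_of_extreme_pts[OF W subspace_unit_graph[OF N(1)]])
      show "unit_graph ` N \<subseteq> contf W" using unit_graph_contf N(2) by blast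
      show "F n \<in> unit_graph ` N" for n unfolding F_def by (rule imageI[OF dN])
      show "(y, c) \<in> W" using c by (simp add: W_def)
      fix n w assume w: "w \<in> W"
      have "\<bar>F n w\<bar> \<le> norm (snd w * (T n f (fst w) - Tinf f (fst w)))"
        unfolding F_def unit_graph_def by (rule abs_re_le)
      also have "\<dots> = norm (T n f (fst w) - Tinf f (fst w))"
        using w by (auto simp: norm_mult W_def)
      also have "\<dots> \<le> norm (T n f (fst w)) + norm (Tinf f (fst w))" by (rule norm_triangle_ineq4)
      also have "\<dots> \<le> B * supn f + supn (Tinf f)"
      proof (rule add_mono)
        have "0 \<le> supn f"
          using norm_le_supn[OF cX subsetD[OF M(2) f]] norm_ge_zero order.trans by blast
        then have "re (T n (\<lambda>_. 1) (fst w)) * supn f \<le> B * supn f"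
          by (rule mult_right_mono[OF T1B])
        then show "norm (T n f (fst w)) \<le> B * supn f" using Tnorm[OF f, of n "fst w"] by linarith
        show "norm (Tinf f (fst w)) \<le> supn (Tinf f)" by (rule norm_le_supn[OF cY Finf])
      qed
      finally show "\<bar>F n w\<bar> \<le> B * supn f + supn (Tinf f)" .
    next
      fix w assume w: "extreme_pt W (unit_graph ` N) w"
      obtain z d where zd: "w = (z, d)" by (cases w)
      have "z \<in> choquet N"
        by (rule extreme_pt_unit_graph_choquet[OF cY N]) (use w in \<open>simp add: W_def zd\<close>)
      from on_boundary[OF this f] have "(\<lambda>n. T n f z - Tinf f z) \<longlonglongrightarrow> 0" by (rule LIM_zero)
      then have "(\<lambda>n. re (d * (T n f z - Tinf f z))) \<longlonglongrightarrow> re (d * 0)"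
        by (intro tendsto_intros)
      then show "(\<lambda>n. F n w) \<longlonglongrightarrow> 0" by (simp add: F_def unit_graph_def zd)
    qed
    then show "(\<lambda>n. re (c * (T n f y - Tinf f y))) \<longlonglongrightarrow> re (c * 0)"
      by (simp add: F_def unit_graph_def)
  qed
qed

theorem theorem3p1:
  fixes X_dummy :: "'a::t2_space" and Y_dummy :: "'b::t2_space"
  assumes "compact (UNIV :: 'a set)" and "compact (UNIV :: 'b set)"
  shows
  "(\<forall>(M :: ('a \<Rightarrow> real) set) (S :: ('a \<Rightarrow> real) set)
      (T :: nat \<Rightarrow> ('a \<Rightarrow> real) \<Rightarrow> ('b \<Rightarrow> real)) (Tinf :: ('a \<Rightarrow> real) \<Rightarrow> ('b \<Rightarrow> real)).
      lin_subspace M \<and> M \<subseteq> CC \<and> self_conjugate (\<lambda>c. c) M \<and>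
      function_space S \<and> S \<subseteq> M \<and>
      (\<forall>n. T n ` M \<subseteq> CC \<and> linear_on M (T n) \<and> positive_on M (T n)) \<and>
      Tinf ` M \<subseteq> CC \<and> isometry_on M Tinf \<and> lin_subspace (Tinf ` M) \<and>
      (\<forall>f\<in>S. \<forall>y. (\<lambda>n. T n f y) \<longlonglongrightarrow> Tinf f y) \<and>
      choquet (kspan ((\<Union>n. T n ` M) \<union> Tinf ` M)) \<subseteq> choquet (Tinf ` S) \<and>
      (\<exists>B. \<forall>n. supn (T n (\<lambda>_. 1)) \<le> B)
      \<longrightarrow> (\<forall>f\<in>M. \<forall>y. (\<lambda>n. T n f y) \<longlonglongrightarrow> Tinf f y))
   \<and>
   (\<forall>(M :: ('a \<Rightarrow> complex) set) (S :: ('a \<Rightarrow> complex) set)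
      (T :: nat \<Rightarrow> ('a \<Rightarrow> complex) \<Rightarrow> ('b \<Rightarrow> complex)) (Tinf :: ('a \<Rightarrow> complex) \<Rightarrow> ('b \<Rightarrow> complex)).
      lin_subspace M \<and> M \<subseteq> CC \<and> self_conjugate cnj M \<and>
      function_space S \<and> S \<subseteq> M \<and>
      (\<forall>n. T n ` M \<subseteq> CC \<and> linear_on M (T n) \<and> positive_on M (T n)) \<and>
      Tinf ` M \<subseteq> CC \<and> isometry_on M Tinf \<and> lin_subspace (Tinf ` M) \<and>
      (\<forall>f\<in>S. \<forall>y. (\<lambda>n. T n f y) \<longlonglongrightarrow> Tinf f y) \<and>
      choquet (kspan ((\<Union>n. T n ` M) \<union> Tinf ` M)) \<subseteq> choquet (Tinf ` S) \<and>
      (\<exists>B. \<forall>n. supn (T n (\<lambda>_. 1)) \<le> B)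
      \<longrightarrow> (\<forall>f\<in>M. \<forall>y. (\<lambda>n. T n f y) \<longlonglongrightarrow> Tinf f y))"
proof (intro conjI allI impI ballI)
  fix M S :: "('a \<Rightarrow> real) set" and T :: "nat \<Rightarrow> ('a \<Rightarrow> real) \<Rightarrow> ('b \<Rightarrow> real)"
    and Tinf :: "('a \<Rightarrow> real) \<Rightarrow> ('b \<Rightarrow> real)" and f y
  assume H: "lin_subspace M \<and> M \<subseteq> CC \<and> self_conjugate (\<lambda>c. c) M \<and>
      function_space S \<and> S \<subseteq> M \<and>
      (\<forall>n. T n ` M \<subseteq> CC \<and> linear_on M (T n) \<and> positive_on M (T n)) \<and>
      Tinf ` M \<subseteq> CC \<and> isometry_on M Tinf \<and> lin_subspace (Tinf ` M) \<and>
      (\<forall>f\<in>S. \<forall>y. (\<lambda>n. T n f y) \<longlonglongrightarrow> Tinf f y) \<and>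
      choquet (kspan ((\<Union>n. T n ` M) \<union> Tinf ` M)) \<subseteq> choquet (Tinf ` S) \<and>
      (\<exists>B. \<forall>n. supn (T n (\<lambda>_. 1)) \<le> B)"
    and f: "f \<in> M"
  then obtain B where B: "\<And>n. supn (T n (\<lambda>_. 1)) \<le> B" by blast
  show "(\<lambda>n. T n f y) \<longlonglongrightarrow> Tinf f y"
    by (rule positive_operators_tendsto[OF assms, of M S T Tinf B]) (use H B f in simp_all)
next
  fix M S :: "('a \<Rightarrow> complex) set" and T :: "nat \<Rightarrow> ('a \<Rightarrow> complex) \<Rightarrow> ('b \<Rightarrow> complex)"
    and Tinf :: "('a \<Rightarrow> complex) \<Rightarrow> ('b \<Rightarrow> complex)" and f y
  assume H: "lin_subspace M \<and> M \<subseteq> CC \<and> self_conjugate cnj M \<and>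
      function_space S \<and> S \<subseteq> M \<and>
      (\<forall>n. T n ` M \<subseteq> CC \<and> linear_on M (T n) \<and> positive_on M (T n)) \<and>
      Tinf ` M \<subseteq> CC \<and> isometry_on M Tinf \<and> lin_subspace (Tinf ` M) \<and>
      (\<forall>f\<in>S. \<forall>y. (\<lambda>n. T n f y) \<longlonglongrightarrow> Tinf f y) \<and>
      choquet (kspan ((\<Union>n. T n ` M) \<union> Tinf ` M)) \<subseteq> choquet (Tinf ` S) \<and>
      (\<exists>B. \<forall>n. supn (T n (\<lambda>_. 1)) \<le> B)"
    and f: "f \<in> M"
  then obtain B where B: "\<And>n. supn (T n (\<lambda>_. 1)) \<le> B" by blast
  have real_part: "(\<lambda>x. complex_of_real (re (g x))) \<in> M" if g: "g \<in> M" for g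
  proof -
    have M: "lin_subspace M" and "self_conjugate cnj M" using H by blast+
    then have "(\<lambda>x. cnj (g x)) \<in> M" using g by (simp add: self_conjugate_def)
    from lin_subspace_lincomb[OF M g this, of "1/2" "1/2"]
    show ?thesis
      by (rule back_subst[of "\<lambda>h. h \<in> M"]) (simp add: fun_eq_iff complex_eq_iff inner_complex_def)
  qed
  show "(\<lambda>n. T n f y) \<longlonglongrightarrow> Tinf f y"
    by (rule positive_operators_tendsto[OF assms, of M S T Tinf B]) (use H B f real_part in simp_all)
qed

end
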